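(* Let $K$ be a disk of radius $h$ centered at the origin, and consider the $p\times p$ cross matrix $S$ with entries $S_{m,\ell}=\int_{\partial K}(\nabla\varphi_m\cdot\mathbf n)\,\overline{\varphi_\ell}\,ds$ resulting from $p$ evenly spaced plane waves. Then the following hold, where $\lambda_L(S)$, $L=0,\dots,p-1$, denote the eigenvalues of the circulant matrix $S$: (1) The generating function of $S$ is $F_S(x)=2\pi\kappa h^2\sin\left(\frac{x}{2}\right)J_1\!\left(2\kappa h\sin\left(\frac{x}{2}\right)\right)$. (2) There is a simple eigenvalue $$\lambda_0(S)=\sum_{j=0}^{p-1}F_S\!\left(\tfrac{2j}{p}\pi\right)\approx p\kappa h^2\int_0^{2\pi}\sin\left(\tfrac{x}{2}\right)J_1\!\left(2\kappa h\sin\left(\tfrac{x}{2}\right)\right)dx .$$ (3) The eigenvalues $\lambda_L(S)$, $L=1,\dots,\left\lfloor\frac{p-1}{2}\right\rfloor$, of $S$ have multiplicity 2 and are given by $$\lambda_L(S)=\sum_{j=0}^{p-1}F_S\!\left(\tfrac{2j}{p}\pi\right)e^{-i\frac{2j}{p}L\pi}\approx 2p\kappa h^2\int_0^{\pi/2}\sin(x)\left[J_{2L+1}(2\kappa h\sin(x))-J_{2L-1}(2\kappa h\sin(x))\right]dx .$$ (4) If $p$ is even, $S$ has an additional simple eigenvalue $$\lambda_{p/2}(S)=\sum_{j=0}^{p-1}(-1)^jF_S\!\left(\tfrac{2j}{p}\pi\right)\approx 2p\kappa h^2\int_0^{\pi/2}\sin(x)\left[J_{p+1}(2\kappa h\sin(x))-J_{p-1}(2\kappa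 h\sin(x))\right]dx .$$
   Context: Plane waves: $\varphi_m(\mathbf x)=e^{i\kappa\,\mathbf d_m\cdot\mathbf x}$ for $\mathbf x\in\mathbb R^2$, where $\kappa$ is the real wave number and $\mathbf d_m=(\cos\theta_m,\sin\theta_m)$, $\theta_m=2\pi m/p$, $m=0,\dots,p-1$. $\mathbf n$ is the unit outward normal to $\partial K$, $ds$ is arclength, and $J_n$ is the Bessel function of the first kind of integer order $n$. A $p\times p$ circulant matrix $C=\mathrm{circ}[c_0,\dots,c_{p-1}]$ is one whose first row is $c_0,\dots,c_{p-1}$ and in which each row is the right cyclic shift of the row above. Its eigenvalues are $\lambda_L(C)=\sum_{j=0}^{p-1}c_je^{-2\pi ijL/p}$, $L=0,\dots,p-1$. A function $f$ on $[0,2\pi]$ is the generating function of $C$ if $c_j=f(2\pi j/p)$ for all $j$. The symbol $\approx$ denotes approximation by the trapezoidal rule, $\sum_{j=0}^{p-1}F(2\pi j/p)e^{-2\pi ijL/p}\approx\frac{p}{2\pi}\int_0^{2\pi}F(x)e^{-iLx}\,dx$; no error bound is part of the statement.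
   Formalization: The factor 2πκh² in F_S is corrected to −2πκh (and κh² to −κh in (2)–(4)); "simple" and "multiplicity 2" are claimed when λ_L differs from the other λ_M, 0≤M≤p/2, which for each p, h holds for all but countably many κ (it fails e.g. at κ=0). *)

theory Defs
  imports "HOL-Analysis.Analysis" "Jordan_Normal_Form.Char_Poly"
begin

section \<open>Bessel functions of the first kind of integer order\<close>

definition bessel_J_nat :: "nat \<Rightarrow> real \<Rightarrow> real" where
  "bessel_J_nat n x = (\<Sum>k. (-1) ^ k / (fact k * fact (k + n)) * (x / 2) ^ (2 * k + n))"

text \<open>For negative integer order the defining power series reduces to
  \<open>J\<^bsub>-n\<^esub> = (-1)\<^sup>n J\<^sub>n\<close>, because \<open>1 / \<Gamma>\<close> vanishes at the nonpositive integers.\<close>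

definition bessel_J :: "int \<Rightarrow> real \<Rightarrow> real" where
  "bessel_J n x = (if n \<ge> 0 then bessel_J_nat (nat n) x
                   else (-1) ^ nat (- n) * bessel_J_nat (nat (- n)) x)"

section \<open>Plane waves and the cross matrix of a disk\<close>

definition plane_wave_angle :: "nat \<Rightarrow> nat \<Rightarrow> real" where
  "plane_wave_angle p m = 2 * pi * real m / real p"

definition plane_wave_dir :: "nat \<Rightarrow> nat \<Rightarrow> real ^ 2" where
  "plane_wave_dir p m = vector [cos (plane_wave_angle p m), sin (plane_wave_angle p m)]"

definition plane_wave :: "nat \<Rightarrow> real \<Rightarrow> nat \<Rightarrow> real ^ 2 \<Rightarrow> complex" where
  "plane_wave p \<kappa> m x = exp (\<i> * complex_of_real (\<kappa> * (plane_wave_dir p m \<bullet> x)))"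

definition gradient :: "(real ^ 2 \<Rightarrow> complex) \<Rightarrow> real ^ 2 \<Rightarrow> complex ^ 2" where
  "gradient f x = (\<chi> i. frechet_derivative f (at x) (axis i 1))"

text \<open>The product is bilinear, without complex conjugation.\<close>

definition normal_component :: "complex ^ 2 \<Rightarrow> real ^ 2 \<Rightarrow> complex" where
  "normal_component g \<nu> = (\<Sum>i\<in>UNIV. vec_nth g i * complex_of_real (vec_nth \<nu> i))"

definition arclength_integral ::
    "real \<Rightarrow> real \<Rightarrow> (real \<Rightarrow> real ^ 2) \<Rightarrow> (real ^ 2 \<Rightarrow> complex) \<Rightarrow> complex" where
  "arclength_integral a b \<gamma> f =
     integral {a..b} (\<lambda>t. f (\<gamma> t) * complex_of_real (norm (vector_derivative \<gamma> (at t))))"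

definition circle_curve :: "real \<Rightarrow> real \<Rightarrow> real ^ 2" where
  "circle_curve h t = vector [h * cos t, h * sin t]"

lemma circle_curve_bij_betw:
  assumes "h > 0"
  shows "bij_betw (circle_curve h) {0..<2 * pi} (frontier (cball (0 :: real ^ 2) h))"
proof -
  have nrm: "norm x = sqrt ((vec_nth x 1)\<^sup>2 + (vec_nth x 2)\<^sup>2)" for x :: "real ^ 2"
    by (simp add: norm_eq_sqrt_inner inner_vec_def sum_2 power2_eq_square)
  have "inj_on (circle_curve h) {0..<2 * pi}"
  proof (rule inj_onI)
    fix s t assume st: "s \<in> {0..<2 * pi}" "t \<in> {0..<2 * pi}"
      and eq: "circle_curve h s = circle_curve h t"
    have "vec_nth (circle_curve h s) i = vec_nth (circle_curve h t) i" for i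
      by (simp add: eq)
    from this[of 1] this[of 2] have "cos s = cos t" "sin s = sin t"
      using assms by (auto simp: circle_curve_def)
    then obtain n :: int where n: "s = t + 2 * pi * n"
      by (metis sin_cos_eq_iff)
    have "\<bar>2 * pi * real_of_int n\<bar> < 2 * pi"
      using st n by auto
    then have "\<bar>real_of_int n\<bar> < 1"
      by (simp add: abs_mult)
    then show "s = t"
      using n by auto
  qed
  moreover have "circle_curve h ` {0..<2 * pi} = sphere 0 h"
  proof (intro equalityI subsetI)
    fix x assume "x \<in> circle_curve h ` {0..<2 * pi}"
    then obtain t where "x = circle_curve h t" by blast
    then have "norm x = sqrt ((h * cos t)\<^sup>2 + (h * sin t)\<^sup>2)"
      by (simp add: nrm circle_curve_def)
    also have "(h * cos t)\<^sup>2 + (h * sin t)\<^sup>2 = h\<^sup>2 * ((cos t)\<^sup>2 + (sin t)\<^sup>2)"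
      by (simp only: power_mult_distrib distrib_left)
    finally have "norm x = h"
      using assms by simp
    then show "x \<in> sphere 0 h"
      using assms by simp
  next
    fix x :: "real ^ 2" assume "x \<in> sphere 0 h"
    then have "(vec_nth x 1)\<^sup>2 + (vec_nth x 2)\<^sup>2 = h\<^sup>2"
      by (auto simp: nrm)
    then have "(vec_nth x 1 / h)\<^sup>2 + (vec_nth x 2 / h)\<^sup>2 = 1"
      using assms by (simp add: power_divide add_divide_distrib[symmetric])
    then obtain t where t: "0 \<le> t" "t < 2 * pi" "vec_nth x 1 / h = cos t" "vec_nth x 2 / h = sin t"
      by (rule sincos_total_2pi)
    then have "x = circle_curve h t"
      using assms by (simp add: Finite_Cartesian_Product.vec_eq_iff forall_2 circle_curve_def field_simps)
    with t show "x \<in> circle_curve h ` {0..<2 * pi}"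
      by auto
  qed
  ultimately show ?thesis
    using assms by (simp add: bij_betw_def)
qed

text \<open>\<^term>\<open>sgn x\<close> is \<open>x / \<bar>x\<bar>\<close>, the unit outward normal of a disk centered at the origin.\<close>

definition cross_entry :: "nat \<Rightarrow> real \<Rightarrow> real \<Rightarrow> nat \<Rightarrow> nat \<Rightarrow> complex" where
  "cross_entry p \<kappa> h m l =
     arclength_integral 0 (2 * pi) (circle_curve h)
       (\<lambda>x. normal_component (gradient (plane_wave p \<kappa> m) x) (sgn x) * cnj (plane_wave p \<kappa> l x))"

definition cross_matrix :: "nat \<Rightarrow> real \<Rightarrow> real \<Rightarrow> complex mat" where
  "cross_matrix p \<kappa> h = Matrix.mat p p (\<lambda>(m, l). cross_entry p \<kappa> h m l)"

section \<open>Circulant matrices\<close>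

definition circulant :: "nat \<Rightarrow> complex mat \<Rightarrow> bool" where
  "circulant p C \<longleftrightarrow> C \<in> carrier_mat p p \<and>
     (\<forall>m l. m + 1 < p \<longrightarrow> l < p \<longrightarrow> C $$ (m + 1, (l + 1) mod p) = C $$ (m, l))"

definition circ_eigenvalue :: "complex mat \<Rightarrow> nat \<Rightarrow> complex" where
  "circ_eigenvalue C L = (let p = dim_col C in
     \<Sum>j<p. C $$ (0, j) * exp (- (2 * complex_of_real pi * \<i> * of_nat j * of_nat L / of_nat p)))"

definition generating_function :: "(real \<Rightarrow> complex) \<Rightarrow> complex mat \<Rightarrow> bool" where
  "generating_function f C \<longleftrightarrow> (let p = dim_col C in
     \<forall>j<p. C $$ (0, j) = f (2 * pi * real j / real p))"

text \<open>Differentiating the plane wave and the Jacobi-Anger expansion each contribute a factor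
  \<open>\<i>\<close>, whence the minus sign; the only power of \<open>h\<close> comes from \<open>ds = h dt\<close>.\<close>

definition F_S :: "real \<Rightarrow> real \<Rightarrow> real \<Rightarrow> real" where
  "F_S \<kappa> h x = - 2 * pi * \<kappa> * h * sin (x / 2) * bessel_J 1 (2 * \<kappa> * h * sin (x / 2))"

text \<open>\<open>trapezoidal_approx p F L s I\<close> reads ``\<open>s \<approx> I\<close>'': \<open>s\<close> is, up to the factor \<open>p / (2 \<pi>)\<close>, the
  \<open>p\<close>-point trapezoidal sum of the \<open>L\<close>-th Fourier integral of \<open>F\<close> over a period, and \<open>I\<close> is that
  integral times the same factor. No error bound is implied.\<close>

definition trapezoidal_approx ::
    "nat \<Rightarrow> (real \<Rightarrow> real) \<Rightarrow> nat \<Rightarrow> complex \<Rightarrow> complex \<Rightarrow> bool" where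
  "trapezoidal_approx p F L s I \<longleftrightarrow>
     s = (\<Sum>j<p. complex_of_real (F (2 * pi * real j / real p)) *
            exp (- (2 * complex_of_real pi * \<i> * of_nat j * of_nat L / of_nat p))) \<and>
     (\<lambda>x. complex_of_real (F x) * exp (- (\<i> * of_nat L * complex_of_real x)))
       integrable_on {0..2 * pi} \<and>
     I = complex_of_real (real p / (2 * pi)) *
         integral {0..2 * pi}
           (\<lambda>x. complex_of_real (F x) * exp (- (\<i> * of_nat L * complex_of_real x)))"

text \<open>The index \<open>L\<close> shares its eigenvalue with none of the other indices in \<open>{0..p div 2}\<close>.
  The indices \<open>L\<close> and \<open>p - L\<close> always yield the same eigenvalue of the cross matrix, so these
  represent all of them.\<close>

definition no_coincidence :: "complex mat \<Rightarrow> nat \<Rightarrow> bool" where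
  "no_coincidence C L \<longleftrightarrow>
     (\<forall>M\<le>dim_col C div 2. M \<noteq> L \<longrightarrow> circ_eigenvalue C M \<noteq> circ_eigenvalue C L)"

end

theory Submission
  imports Defs "HOL-Complex_Analysis.Conformal_Mappings"
begin

text \<open>
  On the circle \<open>x = h n(t)\<close> the product of two plane waves is a single exponential
  \<open>exp (\<i> z sin (t - \<mu>))\<close> with \<open>z = 2 \<kappa> h sin ((\<theta>\<^sub>m - \<theta>\<^sub>\<ell>) / 2)\<close>, so Bessel's integral
  evaluates the entries of \<open>S\<close> as values of \<open>F\<^sub>S\<close> at \<open>\<theta>\<^sub>m - \<theta>\<^sub>\<ell>\<close>. Since \<open>F\<^sub>S\<close> is periodic and even,
  \<open>S\<close> is circulant, the Fourier matrix diagonalizes it, and the indices \<open>L\<close> and \<open>p - L\<close> share an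
  eigenvalue. For the Fourier integrals, insert Bessel's integral for \<open>J\<^sub>1\<close> and exchange the order
  of integration in \<open>sin y sin u exp (\<i> z sin y sin u) exp (-2 \<i> L y)\<close>: the inner integral becomes
  a difference of Bessel functions of order \<open>2 L \<plusminus> 1\<close>. Finally, \<open>\<lambda>\<^sub>L - \<lambda>\<^sub>M\<close> is an
  entire function of \<open>\<kappa>\<^sup>2\<close>; if it vanished identically, all moments of the weights
  \<open>cos (L \<theta>\<^sub>j) - cos (M \<theta>\<^sub>j)\<close> at the points \<open>sin\<^sup>2 (\<theta>\<^sub>j / 2)\<close> would vanish, and interpolating at
  \<open>j = 1\<close> would give \<open>cos (2 \<pi> L / p) = cos (2 \<pi> M / p)\<close>, that is \<open>L = M\<close>. Hence its zeros are countable.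
\<close>

section \<open>Integral representation of the Bessel functions\<close>

text \<open>The M-test makes the partial sums converge uniformly, and a uniform limit may be
  exchanged with the integral over a compact interval.\<close>

lemma integral_sums:
  fixes f :: "nat \<Rightarrow> real \<Rightarrow> 'a :: banach"
  assumes cont: "\<And>k. continuous_on {a..b} (f k)"
    and bound: "\<And>k x. x \<in> {a..b} \<Longrightarrow> norm (f k x) \<le> M k" and M: "summable M"
    and g: "\<And>x. x \<in> {a..b} \<Longrightarrow> (\<lambda>k. f k x) sums g x"
  shows "(\<lambda>k. integral {a..b} (f k)) sums integral {a..b} g"
proof -
  have "uniform_limit {a..b} (\<lambda>n x. \<Sum>i<n. f i x) (\<lambda>x. suminf (\<lambda>i. f i x)) sequentially"
    by (rule Weierstrass_m_test[OF bound M])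
  also have "?this \<longleftrightarrow> uniform_limit {a..b} (\<lambda>n x. \<Sum>i<n. f i x) g sequentially"
    by (intro uniform_limit_cong always_eventually allI ballI refl) (use g in \<open>simp add: sums_iff\<close>)
  finally have unif: "uniform_limit {a..b} (\<lambda>n x. \<Sum>i<n. f i x) g sequentially" .
  obtain I J where IJ: "\<And>n. ((\<lambda>x. \<Sum>i<n. f i x) has_integral I n) {a..b}"
      "(g has_integral J) {a..b}" "I \<longlonglongrightarrow> J"
    by (rule uniform_limit_integral[OF unif]) (auto intro!: continuous_on_sum cont)
  \<comment> \<open>\<open>uniform_limit_integral\<close> only supplies some sequence
    \<open>I\<close> of integrals; uniqueness of the integral identifies it with the termwise
    sums.\<close>
  have "I = (\<lambda>n. \<Sum>i<n. integral {a..b} (f i))"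
  proof
    fix n
    have "((\<lambda>x. \<Sum>i<n. f i x) has_integral (\<Sum>i<n. integral {a..b} (f i))) {a..b}"
      by (intro has_integral_sum integrable_integral integrable_continuous_interval cont) auto
    with IJ(1) show "I n = (\<Sum>i<n. integral {a..b} (f i))"
      by (rule has_integral_unique)
  qed
  with IJ(3) show "(\<lambda>k. integral {a..b} (f k)) sums integral {a..b} g"
    unfolding sums_def integral_unique[OF IJ(2)] by simp
qed

text \<open>Orthogonality of the characters. The phase \<open>\<mu>\<close> has no influence,
  because for integer frequency the antiderivative takes the same value at both ends of the
  period.\<close>

lemma integral_cis:
  "integral {0..2 * pi} (\<lambda>y. cis (of_int m * (y - \<mu>))) = (if m = 0 then of_real (2 * pi) else 0)"
proof (cases "m = 0")
  case False
  have "((\<lambda>y. cis (of_int m * (y - \<mu>))) has_integral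
      (cis (of_int m * (2 * pi - \<mu>)) / (\<i> * of_int m) - cis (of_int m * (0 - \<mu>)) / (\<i> * of_int m))) {0..2 * pi}"
  proof (rule fundamental_theorem_of_calculus)
    fix x
    show "((\<lambda>y. cis (of_int m * (y - \<mu>)) / (\<i> * of_int m)) has_vector_derivative
       cis (of_int m * (x - \<mu>))) (at x within {0..2 * pi})"
      unfolding cis_conv_exp of_real_mult of_real_diff of_real_of_int_eq
      by (rule has_vector_derivative_real_field) (use False in \<open>auto intro!: derivative_eq_intros simp: mult_ac\<close>)
  qed simp
  moreover have "cis (of_int m * (2 * pi - \<mu>)) = cis (of_int m * (0 - \<mu>))"
  proof -
    have "of_int m * (2 * pi - \<mu>) = 2 * pi * of_int m + of_int m * (0 - \<mu>)"
      by (simp add: algebra_simps)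
    then show ?thesis
      by (simp only: cis_mult[symmetric]) (simp add: cis_multiple_2pi)
  qed
  ultimately show ?thesis
    using False by (simp add: integral_unique)
qed (simp add: scaleR_conv_of_real)

text \<open>Expanding the exponential gives terms of frequency \<open>j - k\<close>. Integration
  keeps only \<open>k = j\<close>, and nothing when \<open>j\<close> is negative.\<close>

lemma bessel_inner_integral:
  "integral {0..2 * pi} (\<lambda>y. exp (of_real a * cis (- (y - \<mu>))) * cis (of_int j * (y - \<mu>)))
     = (if j \<ge> 0 then of_real (2 * pi * a ^ nat j / fact (nat j)) else 0)"
proof -
  let ?f = "\<lambda>k y. of_real (a ^ k / fact k) * cis (of_int (j - int k) * (y - \<mu>))"
  have "(\<lambda>k. integral {0..2 * pi} (?f k)) sums
      integral {0..2 * pi} (\<lambda>y. exp (of_real a * cis (- (y - \<mu>))) * cis (of_int j * (y - \<mu>)))"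
  proof (rule integral_sums)
    show "continuous_on {0..2 * pi} (?f k)" for k
      unfolding cis_conv_exp by (intro continuous_intros)
    show "norm (?f k y) \<le> \<bar>a\<bar> ^ k / fact k" for k y
      by (simp add: norm_mult norm_divide norm_power)
    show "summable (\<lambda>k. \<bar>a\<bar> ^ k / fact k)"
      using summable_exp[of "\<bar>a\<bar>"] by (simp add: field_simps)
    fix y
    have "(\<lambda>k. (of_real a * cis (- (y - \<mu>))) ^ k /\<^sub>R fact k * cis (of_int j * (y - \<mu>))) sums
       (exp (of_real a * cis (- (y - \<mu>))) * cis (of_int j * (y - \<mu>)))"
      by (intro sums_mult2 exp_converges)
    moreover have "(of_real a * cis (- (y - \<mu>))) ^ k /\<^sub>R fact k * cis (of_int j * (y - \<mu>)) = ?f k y" for k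
      by (simp add: power_mult_distrib scaleR_conv_of_real Complex.DeMoivre cis_mult field_simps)
    ultimately show "(\<lambda>k. ?f k y) sums (exp (of_real a * cis (- (y - \<mu>))) * cis (of_int j * (y - \<mu>)))"
      by simp
  qed
  \<comment> \<open>A sequence supported at one index, as \<open>sums_single\<close> expects. For
    negative \<open>j\<close> that index is \<open>nat j = 0\<close>, and the value there is
    0.\<close>
  also have "(\<lambda>k. integral {0..2 * pi} (?f k)) =
      (\<lambda>k. if k = nat j then (if j \<ge> 0 then of_real (2 * pi * a ^ nat j / fact (nat j)) else 0) else 0)"
  proof
    fix k
    show "integral {0..2 * pi} (?f k) =
      (if k = nat j then (if j \<ge> 0 then of_real (2 * pi * a ^ nat j / fact (nat j)) else 0) else 0)"
      unfolding integral_mult_right integral_cis by auto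
  qed
  finally show ?thesis
    by (rule sums_unique2) (rule sums_single)
qed

text \<open>Since \<open>fact (k + n) \<ge> 1\<close>, the exponential series at the squared norm of
  \<open>x\<close>, scaled by \<open>norm x ^ n\<close>, is a majorant.\<close>

lemma summable_bessel_series:
  fixes x :: "'a :: {real_normed_field, banach}"
  shows "summable (\<lambda>k. (-1) ^ k / (fact k * fact (k + n)) * x ^ (2 * k + n))"
proof (rule summable_comparison_test')
  show "summable (\<lambda>k. norm x ^ n * ((norm x)\<^sup>2 ^ k / fact k))"
    using summable_exp[of "(norm x)\<^sup>2"] by (intro summable_mult) (simp add: field_simps)
  fix k
  have "1 \<le> (fact (k + n) :: real)" by (rule fact_ge_1)
  then have "1 / (fact k * fact (k + n)) \<le> 1 / (fact k :: real)"
    by (intro divide_left_mono) (auto simp: mult_le_cancel_left1)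
  then have "1 / (fact k * fact (k + n)) * norm x ^ (2 * k + n) \<le> 1 / fact k * norm x ^ (2 * k + n)"
    by (rule mult_right_mono) simp
  then show "norm ((-1) ^ k / (fact k * fact (k + n)) * x ^ (2 * k + n)) \<le>
      norm x ^ n * ((norm x)\<^sup>2 ^ k / fact k)"
    by (simp add: norm_mult norm_divide norm_power power_add power_mult power2_eq_square power_mult_distrib mult_ac)
qed

lemma bessel_J_nat_sums:
  "(\<lambda>k. (-1) ^ k / (fact k * fact (k + n)) * (x / 2) ^ (2 * k + n)) sums bessel_J_nat n x"
  unfolding bessel_J_nat_def by (rule summable_sums[OF summable_bessel_series])

lemma continuous_bessel_integrand:
  "continuous_on S (\<lambda>y. exp (\<i> * of_real (w * sin (y - \<mu>))) * cis (c * (y - \<mu>)))"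
  unfolding cis_conv_exp by (intro continuous_intros)

text \<open>Bessel's integral. The exponential factors as in the generating function of the Bessel
  functions; only the first factor is expanded, and \<open>bessel_inner_integral\<close> integrates
  each term against the second. The free phase \<open>\<mu>\<close> serves the cross entries, whose
  natural origin is the mean of two wave angles.\<close>

lemma bessel_integral:
  "integral {0..2 * pi} (\<lambda>y. exp (\<i> * of_real (w * sin (y - \<mu>))) * cis (- real n * (y - \<mu>)))
     = of_real (2 * pi * bessel_J_nat n w)"
proof -
  let ?g = "\<lambda>y. exp (\<i> * of_real (w * sin (y - \<mu>))) * cis (- real n * (y - \<mu>))"
  let ?f = "\<lambda>j y. of_real ((w / 2) ^ j / fact j) *
      (exp (of_real (- w / 2) * cis (- (y - \<mu>))) * cis (of_int (int j - int n) * (y - \<mu>)))"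
  have split: "exp (\<i> * of_real (w * sin t)) = exp (of_real (w / 2) * cis t) * exp (of_real (- w / 2) * cis (- t))" for t
  proof -
    have "\<i> * of_real (w * sin t) = of_real (w / 2) * cis t + of_real (- w / 2) * cis (- t)"
      by (simp add: complex_eq_iff)
    then show ?thesis by (simp only: exp_add)
  qed
  have "(\<lambda>j. integral {0..2 * pi} (?f j)) sums integral {0..2 * pi} ?g"
  proof (rule integral_sums)
    show "continuous_on {0..2 * pi} (?f j)" for j
      unfolding cis_conv_exp by (intro continuous_intros)
    show "norm (?f j y) \<le> \<bar>w / 2\<bar> ^ j / fact j * exp \<bar>w / 2\<bar>" for j y
    proof -
      have "norm (exp (of_real (- w / 2) * cis (- (y - \<mu>)))) \<le> exp \<bar>w / 2\<bar>"
        using norm_exp[of "of_real (- w / 2) * cis (- (y - \<mu>))"]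
        by (simp only: norm_mult norm_of_real norm_cis) simp
      then show ?thesis
        by (simp only: norm_mult norm_of_real norm_cis abs_divide power_abs abs_of_pos[OF fact_gt_zero] mult_1_right)
           (intro mult_left_mono, auto)
    qed
    show "summable (\<lambda>j. \<bar>w / 2\<bar> ^ j / fact j * exp \<bar>w / 2\<bar>)"
      using summable_exp[of "\<bar>w / 2\<bar>"] by (intro summable_mult2) (simp add: field_simps)
    fix y
    let ?t = "y - \<mu>"
    have "(\<lambda>j. (of_real (w / 2) * cis ?t) ^ j /\<^sub>R fact j * (exp (of_real (- w / 2) * cis (- ?t)) * cis (- real n * ?t)))
       sums (exp (of_real (w / 2) * cis ?t) * (exp (of_real (- w / 2) * cis (- ?t)) * cis (- real n * ?t)))"
      by (intro sums_mult2 exp_converges)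
    moreover have "(of_real (w / 2) * cis ?t) ^ j /\<^sub>R fact j * (exp (of_real (- w / 2) * cis (- ?t)) * cis (- real n * ?t))
        = ?f j y" for j
    proof -
      have "cis ?t ^ j * cis (- real n * ?t) = cis (of_int (int j - int n) * ?t)"
        unfolding Complex.DeMoivre cis_mult by (simp add: algebra_simps)
      then show ?thesis
        by (simp add: power_mult_distrib scaleR_conv_of_real field_simps)
    qed
    ultimately show "(\<lambda>j. ?f j y) sums ?g y"
      unfolding split by (simp add: mult.assoc)
  qed
  moreover have "integral {0..2 * pi} (?f j) =
     (if n \<le> j then of_real (2 * pi * ((w / 2) ^ j / fact j * ((- w / 2) ^ (j - n) / fact (j - n)))) else 0)" for j
    unfolding integral_mult_right bessel_inner_integral by (auto simp: nat_diff_distrib mult_ac)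
  ultimately have "(\<lambda>j. if n \<le> j then of_real (2 * pi * ((w / 2) ^ j / fact j * ((- w / 2) ^ (j - n) / fact (j - n)))) else 0)
      sums integral {0..2 * pi} ?g"
    by simp
  \<comment> \<open>The first \<open>n\<close> terms vanish; with \<open>j = k + n\<close> the rest
    become the terms of the defining series.\<close>
  then have "(\<lambda>k. of_real (2 * pi * ((w / 2) ^ (k + n) / fact (k + n) * ((- w / 2) ^ k / fact k)))) sums integral {0..2 * pi} ?g"
    by (subst (asm) sums_zero_iff_shift[of n, symmetric]) auto
  moreover have "(\<lambda>k. complex_of_real (2 * pi * ((w / 2) ^ (k + n) / fact (k + n) * ((- w / 2) ^ k / fact k)))) sums
      of_real (2 * pi * bessel_J_nat n w)"
  proof -
    have "(w / 2) ^ (k + n) / fact (k + n) * ((- w / 2) ^ k / fact k) =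
       (-1) ^ k / (fact k * fact (k + n)) * (w / 2) ^ (2 * k + n)" for k
      by (subst minus_divide_left[symmetric], subst power_minus)
         (simp add: power_add mult_2 mult_2_right mult_ac)
    then show ?thesis
      by (intro sums_of_real) (use sums_mult[OF bessel_J_nat_sums] in simp)
  qed
  ultimately show ?thesis
    by (rule sums_unique2)
qed

section \<open>Parity and continuity of the Bessel functions\<close>

lemma bessel_J_nat_minus: "bessel_J_nat n (- x) = (-1) ^ n * bessel_J_nat n x"
proof -
  have "(\<lambda>k. (-1) ^ n * ((-1) ^ k / (fact k * fact (k + n)) * (x / 2) ^ (2 * k + n)))
      sums ((-1) ^ n * bessel_J_nat n x)"
    by (intro sums_mult bessel_J_nat_sums)
  moreover have "(-1) ^ n * ((-1) ^ k / (fact k * fact (k + n)) * (x / 2) ^ (2 * k + n)) =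
      (-1) ^ k / (fact k * fact (k + n)) * (- x / 2) ^ (2 * k + n)" for k
    unfolding minus_divide_left[symmetric] power_minus[of "x / 2"] by (simp add: power_add)
  ultimately have "(\<lambda>k. (-1) ^ k / (fact k * fact (k + n)) * (- x / 2) ^ (2 * k + n))
      sums ((-1) ^ n * bessel_J_nat n x)"
    by (simp only:)
  then show ?thesis
    by (rule sums_unique2[OF bessel_J_nat_sums])
qed

text \<open>Conjugation reverses the frequency and the sign of \<open>w\<close>; for odd
  \<open>n\<close> the parity of the Bessel function then yields the minus sign.\<close>

lemma bessel_integral_odd:
  assumes "odd n"
  shows "integral {0..2 * pi} (\<lambda>y. exp (\<i> * of_real (w * sin (y - \<mu>))) * cis (real n * (y - \<mu>)))
     = - of_real (2 * pi * bessel_J_nat n w)"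
proof -
  have "integral {0..2 * pi} (\<lambda>y. exp (\<i> * of_real (w * sin (y - \<mu>))) * cis (real n * (y - \<mu>)))
     = integral {0..2 * pi} (\<lambda>y. cnj (exp (\<i> * of_real (- w * sin (y - \<mu>))) * cis (- real n * (y - \<mu>))))"
    by (simp add: exp_cnj cis_cnj)
  also have "\<dots> = cnj (of_real (2 * pi * bessel_J_nat n (- w)))"
    unfolding integral_cnj[symmetric] bessel_integral ..
  also have "\<dots> = - of_real (2 * pi * bessel_J_nat n w)"
    using assms by (simp add: bessel_J_nat_minus)
  finally show ?thesis .
qed

text \<open>Bessel's integral has a jointly continuous integrand over a compact interval, so it
  depends continuously on the parameter \<open>w\<close>.\<close>

lemma continuous_on_bessel_J_nat: "continuous_on UNIV (bessel_J_nat n)"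
proof -
  have "continuous_on UNIV (\<lambda>w. integral (cbox 0 (2 * pi))
      (\<lambda>y. exp (\<i> * of_real (w * sin (y - 0))) * cis (- real n * (y - 0))))"
    unfolding cis_conv_exp
    by (rule integral_continuous_on_param) (auto simp: case_prod_unfold intro!: continuous_intros)
  then have "continuous_on UNIV (\<lambda>w. complex_of_real (2 * pi * bessel_J_nat n w))"
    unfolding cbox_interval bessel_integral .
  then have "continuous_on UNIV (\<lambda>w. Re (complex_of_real (2 * pi * bessel_J_nat n w)) / (2 * pi))"
    by (intro continuous_on_divide continuous_on_Re continuous_on_const) auto
  then show ?thesis
    unfolding Re_complex_of_real by simp
qed

lemma continuous_on_bessel_J [continuous_intros]:
  assumes "continuous_on S f"
  shows "continuous_on S (\<lambda>x. bessel_J n (f x))"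
proof -
  have "continuous_on S (\<lambda>x. bessel_J_nat k (f x))" for k
    by (rule continuous_on_compose2[OF continuous_on_bessel_J_nat assms]) auto
  then show ?thesis
    unfolding bessel_J_def by (cases "n \<ge> 0") (auto intro!: continuous_intros)
qed

lemma bessel_integrand_integrable:
  "(\<lambda>y. exp (\<i> * of_real (w * sin (y - \<mu>))) * cis (c * (y - \<mu>))) integrable_on {0..2 * pi}"
  by (intro integrable_continuous_interval continuous_bessel_integrand)

text \<open>The cosine splits into frequencies 1 and -1, whose Bessel integrals are opposite, so
  their phases combine to \<open>sin c\<close>. Each cross entry reduces to an integral of this
  form.\<close>

lemma bessel_integral_cos:
  "integral {0..2 * pi} (\<lambda>y. of_real (cos (y - \<mu> - c)) * exp (\<i> * of_real (w * sin (y - \<mu>)))) =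
     of_real (2 * pi * sin c * bessel_J_nat 1 w) * \<i>"
proof -
  let ?f = "\<lambda>s y. exp (\<i> * of_real (w * sin (y - \<mu>))) * cis (s * (y - \<mu>))"
  have "of_real (cos (y - \<mu> - c)) * exp (\<i> * of_real (w * sin (y - \<mu>))) =
      cis (- c) / 2 * ?f 1 y + cis c / 2 * ?f (-1) y" for y
  proof -
    have "of_real (cos (u - c)) = cis (- c) / 2 * cis u + cis c / 2 * cis (- u)" for u
      by (simp add: complex_eq_iff cos_diff field_simps)
    from this[of "y - \<mu>"] show ?thesis by (simp add: algebra_simps)
  qed
  then have "integral {0..2 * pi} (\<lambda>y. of_real (cos (y - \<mu> - c)) * exp (\<i> * of_real (w * sin (y - \<mu>)))) =
      cis (- c) / 2 * integral {0..2 * pi} (?f 1) + cis c / 2 * integral {0..2 * pi} (?f (-1))"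
    by (simp only: integral_add integral_mult_right integrable_on_mult_right bessel_integrand_integrable)
  also have "\<dots> = of_real (2 * pi * bessel_J_nat 1 w) * ((cis c - cis (- c)) / 2)"
    using bessel_integral[where n = 1 and w = w and \<mu> = \<mu>]
      bessel_integral_odd[where n = 1 and w = w and \<mu> = \<mu>]
    by (simp add: field_simps)
  also have "(cis c - cis (- c)) / 2 = of_real (sin c) * \<i>"
    by (simp add: complex_eq_iff)
  finally show ?thesis by simp
qed

lemma bessel_J_minus_odd:
  assumes "odd n"
  shows "bessel_J n (- x) = - bessel_J n x"
  using assms by (simp add: bessel_J_def bessel_J_nat_minus even_nat_iff)

section \<open>The entries of the cross matrix\<close>

lemma gradient_plane_wave:
  "vec_nth (gradient (plane_wave p \<kappa> m) x) i =
     \<i> * of_real (\<kappa> * vec_nth (plane_wave_dir p m) i) * plane_wave p \<kappa> m x"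
proof -
  have "(plane_wave p \<kappa> m has_derivative
      (\<lambda>v. \<i> * of_real (\<kappa> * (plane_wave_dir p m \<bullet> v)) * plane_wave p \<kappa> m x)) (at x)"
  proof -
    have "((\<lambda>x. \<i> * of_real (\<kappa> * (plane_wave_dir p m \<bullet> x))) has_derivative
        (\<lambda>v. \<i> * of_real (\<kappa> * (plane_wave_dir p m \<bullet> v)))) (at x)"
      by (intro derivative_intros bounded_linear_imp_has_derivative)
        (auto intro!: bounded_linear_intros)
    from has_derivative_compose[OF this DERIV_exp[unfolded has_field_derivative_def]] show ?thesis
      unfolding plane_wave_def by (simp add: mult_ac)
  qed
  from frechet_derivative_at[OF this, symmetric] show ?thesis
    by (simp add: gradient_def inner_axis)
qed

lemma normal_component_gradient_plane_wave:
  "normal_component (gradient (plane_wave p \<kappa> m) x) \<nu> =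
     \<i> * of_real (\<kappa> * (plane_wave_dir p m \<bullet> \<nu>)) * plane_wave p \<kappa> m x"
  by (simp add: normal_component_def gradient_plane_wave inner_vec_def sum_distrib_left sum_distrib_right mult_ac)

lemma plane_wave_dir_inner:
  "plane_wave_dir p m \<bullet> (vector [r * cos t, r * sin t]) = r * cos (t - plane_wave_angle p m)"
  by (simp add: plane_wave_dir_def inner_vec_def sum_2 cos_diff algebra_simps)

text \<open>The factors \<open>1 *\<close> make the right-hand side an instance of
  \<open>plane_wave_dir_inner\<close> with \<open>r = 1\<close>.\<close>

lemma sgn_circle_curve:
  assumes "h > 0"
  shows "sgn (circle_curve h t) = vector [1 * cos t, 1 * sin t]"
proof -
  have "norm (circle_curve h t) = sqrt (h\<^sup>2 * ((cos t)\<^sup>2 + (sin t)\<^sup>2))"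
    unfolding distrib_left
    by (simp add: circle_curve_def norm_eq_sqrt_inner inner_vec_def sum_2 power2_eq_square mult_ac
        del: sin_cos_squared_add sin_cos_squared_add2 sin_cos_squared_add3)
  then have "norm (circle_curve h t) = h" using assms by simp
  then show ?thesis
    using assms by (simp add: sgn_div_norm circle_curve_def Finite_Cartesian_Product.vec_eq_iff forall_2)
qed

lemma norm_vector_derivative_circle_curve:
  assumes "h > 0"
  shows "norm (vector_derivative (circle_curve h) (at t)) = h"
proof -
  \<comment> \<open>Written with basis vectors, the curve is accessible to the derivative rules for
    \<open>scaleR\<close>.\<close>
  have eq: "circle_curve h = (\<lambda>t. (h * cos t) *\<^sub>R axis 1 1 + (h * sin t) *\<^sub>R axis 2 1)"
    by (auto simp: circle_curve_def Finite_Cartesian_Product.vec_eq_iff forall_2 axis_def)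
  have "(circle_curve h has_vector_derivative
      (- h * sin t) *\<^sub>R axis 1 1 + (h * cos t) *\<^sub>R axis 2 1) (at t)"
    unfolding eq by (auto intro!: derivative_eq_intros simp: mult_ac)
  then have "vector_derivative (circle_curve h) (at t) =
      (- h * sin t) *\<^sub>R axis 1 1 + (h * cos t) *\<^sub>R axis 2 1"
    by (rule vector_derivative_at)
  then have "norm (vector_derivative (circle_curve h) (at t)) = sqrt (h\<^sup>2 * (cos t)\<^sup>2 + h\<^sup>2 * (sin t)\<^sup>2)"
    by (simp only: norm_eq_sqrt_inner inner_vec_def sum_2) (simp add: axis_def power2_eq_square mult_ac)
  also have "\<dots> = sqrt (h\<^sup>2 * ((cos t)\<^sup>2 + (sin t)\<^sup>2))"
    by (simp only: distrib_left)
  finally show ?thesis using assms by simp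
qed

text \<open>Measured from the mean angle \<open>(a + b) / 2\<close>, the phase difference of the two
  waves is a multiple of a single sine, so \<open>bessel_integral_cos\<close> applies with
  \<open>c = (a - b) / 2\<close>. The factor \<open>\<i>\<close> of the gradient and the one of that
  integral multiply to -1.\<close>

lemma cross_entry_eq_F_S:
  assumes h: "h > 0"
  shows "cross_entry p \<kappa> h m l = of_real (F_S \<kappa> h (plane_wave_angle p m - plane_wave_angle p l))"
proof -
  define a where "a = plane_wave_angle p m"
  define b where "b = plane_wave_angle p l"
  have "normal_component (gradient (plane_wave p \<kappa> m) (circle_curve h t)) (sgn (circle_curve h t)) *
      cnj (plane_wave p \<kappa> l (circle_curve h t)) *
      of_real (norm (vector_derivative (circle_curve h) (at t))) =
    \<i> * of_real (\<kappa> * h) * (of_real (cos (t - (a + b) / 2 - (a - b) / 2)) *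
      exp (\<i> * of_real (2 * \<kappa> * h * sin ((a - b) / 2) * sin (t - (a + b) / 2))))" for t
  proof -
    have cosdiff: "cos (t - a) - cos (t - b) = 2 * sin ((a - b) / 2) * sin (t - (a + b) / 2)"
      unfolding cos_diff_cos by (simp add: field_simps)
    have "plane_wave p \<kappa> m (circle_curve h t) * cnj (plane_wave p \<kappa> l (circle_curve h t)) =
        exp (\<i> * of_real (\<kappa> * h * (cos (t - a) - cos (t - b))))"
      by (simp add: plane_wave_def circle_curve_def plane_wave_dir_inner a_def b_def exp_cnj exp_add[symmetric] algebra_simps)
    also have "\<kappa> * h * (cos (t - a) - cos (t - b)) = 2 * \<kappa> * h * sin ((a - b) / 2) * sin (t - (a + b) / 2)"
      unfolding cosdiff by simp
    finally have *: "plane_wave p \<kappa> m (circle_curve h t) * cnj (plane_wave p \<kappa> l (circle_curve h t)) =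
      exp (\<i> * of_real (2 * \<kappa> * h * sin ((a - b) / 2) * sin (t - (a + b) / 2)))" .
    have **: "t - (a + b) / 2 - (a - b) / 2 = t - a" by (simp add: field_simps)
    show ?thesis
      unfolding normal_component_gradient_plane_wave sgn_circle_curve[OF h] plane_wave_dir_inner
        norm_vector_derivative_circle_curve[OF h] *[symmetric] ** a_def[symmetric]
      by (simp add: mult_ac)
  qed
  then have "cross_entry p \<kappa> h m l = \<i> * of_real (\<kappa> * h) * (of_real (2 * pi * sin ((a - b) / 2) *
      bessel_J_nat 1 (2 * \<kappa> * h * sin ((a - b) / 2))) * \<i>)"
    unfolding cross_entry_def arclength_integral_def
    by (simp only: integral_mult_right bessel_integral_cos)
  then show ?thesis
    by (simp add: F_S_def bessel_J_def a_def b_def mult_ac)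
qed

text \<open>The sine and \<open>bessel_J 1\<close> are both odd, so their sign changes cancel. The
  same happens under a shift by \<open>2 * pi\<close>, which changes the sign of
  \<open>sin (x / 2)\<close>.\<close>

lemma F_S_minus: "F_S \<kappa> h (- x) = F_S \<kappa> h x"
  by (simp add: F_S_def bessel_J_def bessel_J_nat_minus)

lemma F_S_periodic: "F_S \<kappa> h (x + 2 * pi) = F_S \<kappa> h x"
  by (simp add: F_S_def bessel_J_def bessel_J_nat_minus add_divide_distrib)

section \<open>Spectrum of circulant matrices\<close>

lemma circ_exp_cis: "exp (- (2 * complex_of_real pi * \<i> * of_nat j * of_nat L / of_nat p)) =
   cis (- (2 * pi * real j * real L / real p))"
  by (simp add: cis_conv_exp algebra_simps)

text \<open>A geometric sum over a \<open>p\<close>-th root of unity, which differs from 1 because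
  \<open>a - b\<close> is nonzero and smaller than \<open>p\<close> in modulus. This is what makes
  the Fourier matrix invertible.\<close>

lemma cis_sum_roots:
  assumes "p \<ge> 1" "a < p" "b < p"
  shows "(\<Sum>k<p. cis (2 * pi * real k * (real a - real b) / real p)) = (if a = b then of_nat p else 0)"
proof (cases "a = b")
  case False
  define z where "z = cis (2 * pi * (real a - real b) / real p)"
  have "z ^ p = cis (2 * pi * (real a - real b))"
    using assms by (simp add: z_def Complex.DeMoivre)
  also have "\<dots> = 1"
    using cis_multiple_2pi[of "real a - real b"] by simp
  finally have "z ^ p = 1" .
  have "z \<noteq> 1"
  proof
    assume "z = 1"
    then have "cos (2 * pi * (real a - real b) / real p) = 1"
      by (auto simp: z_def complex_eq_iff)
    then obtain n :: int where "2 * pi * (real a - real b) / real p = of_int n * 2 * pi"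
      by (auto simp: cos_one_2pi_int)
    then have "2 * pi * (real a - real b) = 2 * pi * (of_int n * real p)"
      using assms by (simp add: divide_eq_eq mult_ac)
    then have "real a - real b = of_int n * real p"
      by (metis mult_left_cancel pi_neq_zero mult_eq_0_iff zero_neq_numeral)
    then have "of_int (int a - int b) = (of_int (n * int p) :: real)"
      by simp
    then have "int a - int b = n * int p"
      by (simp only: of_int_eq_iff)
    then have "int p dvd int a - int b" by simp
    moreover have "\<bar>int a - int b\<bar> < int p" "int a - int b \<noteq> 0"
      using assms False by auto
    ultimately show False
      using zdvd_not_zless by (metis abs_dvd_iff dvd_abs_iff zero_less_abs_iff)
  qed
  have "(\<Sum>k<p. cis (2 * pi * real k * (real a - real b) / real p)) = (\<Sum>k<p. z ^ k)"
    by (intro sum.cong refl) (simp add: z_def Complex.DeMoivre mult_ac)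
  also have "\<dots> = 0"
    using \<open>z \<noteq> 1\<close> \<open>z ^ p = 1\<close> by (simp add: geometric_sum)
  finally show ?thesis using False by simp
qed simp

text \<open>Going down one row and right one column, cyclically, preserves the entry; induction on
  the row leads back to row 0.\<close>

lemma circulant_entry:
  assumes "circulant p C" "m < p" "j < p"
  shows "C $$ (m, (m + j) mod p) = C $$ (0, j)"
  using assms(2)
proof (induction m)
  case (Suc m)
  have "C $$ (m + 1, ((m + j) mod p + 1) mod p) = C $$ (m, (m + j) mod p)"
    using assms(1) Suc.prems unfolding circulant_def by (metis Suc_eq_plus1 mod_less_divisor less_nat_zero_code not_gr_zero)
  with Suc show ?case by (simp add: mod_Suc_eq)
qed (use assms in simp)

lemma sum_mod_shift:
  fixes f :: "nat \<Rightarrow> 'a :: comm_monoid_add"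
  assumes "m < p"
  shows "(\<Sum>l<p. f l) = (\<Sum>j<p. f ((m + j) mod p))"
proof -
  have "inj_on (\<lambda>j. (m + j) mod p) {..<p}"
  proof (rule linorder_inj_onI)
    fix i j assume "i < j" "i \<in> {..<p}" "j \<in> {..<p}"
    then have "\<not> p dvd (m + j) - (m + i)"
      by (auto dest: dvd_imp_le)
    then show "(m + i) mod p \<noteq> (m + j) mod p"
      using \<open>i < j\<close> mod_eq_dvd_iff_nat[of "m + i" "m + j" p] by auto
  qed auto
  moreover have "(\<lambda>j. (m + j) mod p) ` {..<p} \<subseteq> {..<p}"
    using assms by auto
  ultimately have "bij_betw (\<lambda>j. (m + j) mod p) {..<p} {..<p}"
    by (simp add: bij_betw_def endo_inj_surj)
  from sum.reindex_bij_betw[OF this, of f] show ?thesis by simp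
qed

lemma cis_mod:
  assumes "p \<ge> 1"
  shows "cis (- (2 * pi * real (k mod p) * real L / real p)) = cis (- (2 * pi * real k * real L / real p))"
proof -
  have "real k = real (k mod p) + real p * real (k div p)"
    by (metis mod_mult_div_eq of_nat_add of_nat_mult)
  then have "- (2 * pi * real k * real L / real p) =
      - (2 * pi * real (k mod p) * real L / real p) + 2 * pi * (- real (k div p * L))"
    using assms by (simp add: field_simps)
  then show ?thesis
    using cis_multiple_2pi[of "- real (k div p * L)"] by (simp only: cis_mult[symmetric]) simp
qed

text \<open>The columns of the Fourier matrix \<open>W\<close> are eigenvectors and \<open>V\<close>
  is its inverse, so \<open>C\<close> is similar to the diagonal matrix \<open>D\<close>. Working
  with the characteristic polynomial also counts multiplicities.\<close>

lemma char_poly_circulant: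
  assumes C: "circulant p C" and p: "p \<ge> 1"
  shows "char_poly C = (\<Prod>L<p. [:- circ_eigenvalue C L, 1:])"
proof -
  define W where "W = Matrix.mat p p (\<lambda>(j, L). cis (- (2 * pi * real j * real L / real p)))"
  define V where "V = Matrix.mat p p (\<lambda>(L, j). cis (2 * pi * real L * real j / real p) / of_nat p)"
  define D where "D = Matrix.mat p p (\<lambda>(i, j). if i = j then circ_eigenvalue C i else 0)"
  have carr: "W \<in> carrier_mat p p" "V \<in> carrier_mat p p" "D \<in> carrier_mat p p" "C \<in> carrier_mat p p"
    using C by (auto simp: W_def V_def D_def circulant_def)
  have VW: "V * W = 1\<^sub>m p"
  proof (rule eq_matI)
    fix a b assume "a < dim_row (1\<^sub>m p)" "b < dim_col (1\<^sub>m p)"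
    then have ab: "a < p" "b < p" by auto
    then have "(V * W) $$ (a, b) = (\<Sum>k<p. cis (2 * pi * real a * real k / real p) / of_nat p *
        cis (- (2 * pi * real k * real b / real p)))"
      by (simp add: V_def W_def scalar_prod_def atLeast0LessThan)
    also have "\<dots> = (\<Sum>k<p. cis (2 * pi * real k * (real a - real b) / real p) / of_nat p)"
      by (intro sum.cong refl) (simp add: cis_mult diff_divide_distrib[symmetric] algebra_simps)
    also have "\<dots> = (if a = b then 1 else 0)"
      unfolding sum_divide_distrib[symmetric] cis_sum_roots[OF p ab] using p by simp
    finally show "(V * W) $$ (a, b) = 1\<^sub>m p $$ (a, b)"
      using ab by simp
  qed (use carr in auto)
  then have WV: "W * V = 1\<^sub>m p"
    using mat_mult_left_right_inverse carr by blast
  have CW: "C * W = W * D"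
  proof (rule eq_matI)
    fix m L assume "m < dim_row (W * D)" "L < dim_col (W * D)"
    then have mL: "m < p" "L < p" using carr by auto
    let ?e = "\<lambda>k. cis (- (2 * pi * real k * real L / real p))"
    have "(C * W) $$ (m, L) = (\<Sum>l<p. C $$ (m, l) * ?e l)"
      using mL carr by (simp add: W_def scalar_prod_def atLeast0LessThan)
    \<comment> \<open>Summing row \<open>m\<close> from its diagonal entry onwards lets the entries
      be replaced by those of row 0, at the cost of the common factor \<open>?e m\<close>.\<close>
    also have "\<dots> = (\<Sum>j<p. C $$ (m, (m + j) mod p) * ?e ((m + j) mod p))"
      by (rule sum_mod_shift[OF mL(1)])
    also have "\<dots> = (\<Sum>j<p. ?e m * (C $$ (0, j) * ?e j))"
    proof (intro sum.cong refl)
      fix j assume "j \<in> {..<p}"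
      then have "C $$ (m, (m + j) mod p) = C $$ (0, j)"
        using circulant_entry[OF C mL(1)] by simp
      moreover have "?e ((m + j) mod p) = ?e m * ?e j"
        unfolding cis_mod[OF p] cis_mult by (simp add: algebra_simps add_divide_distrib)
      ultimately show "C $$ (m, (m + j) mod p) * ?e ((m + j) mod p) = ?e m * (C $$ (0, j) * ?e j)"
        by simp
    qed
    also have "\<dots> = ?e m * circ_eigenvalue C L"
      using carr by (simp add: circ_eigenvalue_def circ_exp_cis sum_distrib_left)
    also have "\<dots> = (\<Sum>k<p. W $$ (m, k) * D $$ (k, L))"
      using mL by (simp add: W_def D_def if_distrib sum.delta cong: if_cong)
    also have "\<dots> = (W * D) $$ (m, L)"
      using mL carr by (simp add: scalar_prod_def atLeast0LessThan)
    finally show "(C * W) $$ (m, L) = (W * D) $$ (m, L)" .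
  qed (use carr in auto)
  have "C = C * (W * V)"
    using WV carr by simp
  also have "\<dots> = W * D * V"
    unfolding CW[symmetric] using carr by (intro assoc_mult_mat[symmetric])
  finally have "similar_mat_wit C D W V"
    using carr WV VW by (intro similar_mat_witI)
  then have "char_poly C = char_poly D"
    by (intro char_poly_similar) (auto simp: similar_mat_def)
  also have "\<dots> = (\<Prod>a\<leftarrow>diag_mat D. [:- a, 1:])"
    by (rule char_poly_upper_triangular[OF carr(3)]) (auto simp: D_def)
  also have "diag_mat D = map (circ_eigenvalue C) [0..<p]"
    by (auto simp: diag_mat_def D_def)
  also have "(\<Prod>a\<leftarrow>map (circ_eigenvalue C) [0..<p]. [:- a, 1:]) = (\<Prod>L<p. [:- circ_eigenvalue C L, 1:])"
    by (simp add: prod.distinct_set_conv_list[symmetric] atLeast0LessThan comp_def)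
  finally show ?thesis .
qed

text \<open>The reflection \<open>L \<mapsto> p - L\<close> pairs the indices other than 0; only
  \<open>p div 2\<close>, for even \<open>p\<close>, is its own partner. Each pair contributes a
  square.\<close>

lemma prod_reflect:
  fixes f :: "nat \<Rightarrow> 'a :: comm_monoid_mult"
  assumes p: "p \<ge> 1" and f: "\<And>L. L < p \<Longrightarrow> 0 < L \<Longrightarrow> f (p - L) = f L"
  shows "(\<Prod>L<p. f L) = f 0 * (\<Prod>L\<in>{1..(p - 1) div 2}. f L ^ 2) * (if even p then f (p div 2) else 1)"
proof -
  let ?A = "{1..(p - 1) div 2}" and ?B = "{p - (p - 1) div 2..<p}" and ?E = "if even p then {p div 2} else {}"
  have "{..<p} = ({0} \<union> ?A) \<union> (?B \<union> ?E)"
    using p by (cases "even p") (auto elim!: evenE oddE)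
  then have "prod f {..<p} = prod f (({0} \<union> ?A) \<union> (?B \<union> ?E))" by simp
  also have "\<dots> = (f 0 * prod f ?A) * (prod f ?B * prod f ?E)"
  proof -
    have "({0} \<union> ?A) \<inter> (?B \<union> ?E) = {}" "?B \<inter> ?E = {}"
      using p by (auto elim!: evenE)
    then show ?thesis by (simp add: prod.union_disjoint mult_ac)
  qed
  also have "prod f ?B = prod f ?A"
    by (rule prod.reindex_bij_witness[of _ "\<lambda>j. p - j" "\<lambda>j. p - j"]) (use p f in auto)
  also have "(f 0 * prod f ?A) * (prod f ?A * prod f ?E) = f 0 * (\<Prod>L\<in>?A. f L ^ 2) * prod f ?E"
    by (simp add: power2_eq_square prod.distrib mult_ac)
  finally show ?thesis by (auto split: if_splits)
qed

lemma order_linear_power_mult: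
  fixes a :: "'a :: idom"
  assumes "poly q a \<noteq> 0"
  shows "Polynomial.order a ([:- a, 1:] ^ n * q) = n"
proof -
  have "[:- a, 1:] ^ n * q \<noteq> 0" using assms by auto
  then show ?thesis
    unfolding order_mult[OF \<open>[:- a, 1:] ^ n * q \<noteq> 0\<close>] order_power_n_n order_0I[OF assms] by simp
qed

section \<open>Eigenvalues of the cross matrix\<close>

lemma cross_matrix_dim [simp]: "cross_matrix p \<kappa> h \<in> carrier_mat p p"
    "dim_col (cross_matrix p \<kappa> h) = p"
  by (simp_all add: cross_matrix_def)

text \<open>In row 0 the angle difference is negative; evenness of \<open>F_S\<close> removes the
  sign.\<close>

lemma cross_matrix_first_row:
  assumes "h > 0" "j < p"
  shows "cross_matrix p \<kappa> h $$ (0, j) = of_real (F_S \<kappa> h (2 * pi * real j / real p))"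
  using assms F_S_minus[of \<kappa> h "2 * pi * real j / real p"]
  by (simp add: cross_matrix_def cross_entry_eq_F_S plane_wave_angle_def)

lemma circulant_cross_matrix:
  assumes h: "h > 0"
  shows "circulant p (cross_matrix p \<kappa> h)"
  unfolding circulant_def
proof (intro conjI allI impI)
  fix m l assume ml: "m + 1 < p" "l < p"
  let ?a = "plane_wave_angle p"
  have "F_S \<kappa> h (?a (m + 1) - ?a ((l + 1) mod p)) = F_S \<kappa> h (?a m - ?a l)"
  proof (cases "l + 1 < p")
    case True
    then have "?a (m + 1) - ?a ((l + 1) mod p) = ?a m - ?a l"
      by (simp add: plane_wave_angle_def field_simps)
    then show ?thesis by simp
  next
    case False
    \<comment> \<open>The wrap-around case: the column index jumps back to 0, which shifts the angle
      difference by a full period.\<close>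
    then have "p = l + 1" using ml by simp
    then have p: "real l = real p - 1" "(l + 1) mod p = 0" "p > 0" by simp_all
    have "?a (m + 1) - ?a ((l + 1) mod p) = (?a m - ?a l) + 2 * pi"
      using p(3) unfolding plane_wave_angle_def p by (simp add: field_simps)
    then show ?thesis by (simp only: F_S_periodic)
  qed
  then show "cross_matrix p \<kappa> h $$ (m + 1, (l + 1) mod p) = cross_matrix p \<kappa> h $$ (m, l)"
    using ml by (simp add: cross_matrix_def cross_entry_eq_F_S[OF h])
qed simp

lemma circ_eigenvalue_cross_matrix:
  assumes "h > 0"
  shows "circ_eigenvalue (cross_matrix p \<kappa> h) L =
    (\<Sum>j<p. of_real (F_S \<kappa> h (2 * pi * real j / real p)) * cis (- (2 * pi * real j * real L / real p)))"
  using assms by (simp add: circ_eigenvalue_def circ_exp_cis cross_matrix_first_row)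

text \<open>Replacing \<open>j\<close> by \<open>p - j\<close> in the sum preserves the values of
  \<open>F_S\<close> and, together with \<open>L \<mapsto> p - L\<close>, the exponentials.\<close>

lemma circ_eigenvalue_reflect:
  assumes h: "h > 0" and L: "L \<le> p"
  shows "circ_eigenvalue (cross_matrix p \<kappa> h) (p - L) = circ_eigenvalue (cross_matrix p \<kappa> h) L"
proof (cases "p = 0")
  case False
  then have p: "p \<ge> 1" by simp
  define f where "f K j = complex_of_real (F_S \<kappa> h (2 * pi * real j / real p)) *
    cis (- (2 * pi * real j * real K / real p))" for K j :: nat
  \<comment> \<open>The index 0 has no partner in the range; its term vanishes because
    \<open>F_S\<close> does at 0.\<close>
  have drop0: "sum (f K) {..<p} = sum (f K) {1..<p}" for K
  proof -
    have "{..<p} = insert 0 {1..<p}" using p by auto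
    moreover have "f K 0 = 0" by (simp add: f_def F_S_def)
    ultimately show ?thesis by simp
  qed
  have refl: "f (p - L) (p - j) = f L j" if "j \<in> {1..<p}" for j
  proof -
    have "2 * pi * real (p - j) / real p = - (2 * pi * real j / real p) + 2 * pi"
      using that by (simp add: of_nat_diff field_simps)
    then have "F_S \<kappa> h (2 * pi * real (p - j) / real p) = F_S \<kappa> h (2 * pi * real j / real p)"
      by (simp only: F_S_periodic F_S_minus)
    moreover have "cis (- (2 * pi * real (p - j) * real (p - L) / real p)) = cis (- (2 * pi * real j * real L / real p))"
    proof -
      \<comment> \<open>Expanding \<open>(p - j) * (p - L) / p\<close> leaves
        \<open>j * L / p\<close> and this integer, up to sign.\<close>
      define k where "k = real j + real L - real p"
      have "- (2 * pi * real (p - j) * real (p - L) / real p) = - (2 * pi * real j * real L / real p) + 2 * pi * k"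
        using that L by (simp add: k_def of_nat_diff field_simps)
      moreover have "k \<in> \<int>" by (simp add: k_def)
      ultimately show ?thesis
        by (simp only: cis_mult[symmetric] cis_multiple_2pi) simp
    qed
    ultimately show ?thesis unfolding f_def by simp
  qed
  have "sum (f L) {1..<p} = sum (f (p - L)) {1..<p}"
    by (rule sum.reindex_bij_witness[of _ "\<lambda>j. p - j" "\<lambda>j. p - j"]) (use refl in auto)
  then show ?thesis
    unfolding circ_eigenvalue_cross_matrix[OF h] f_def[symmetric] drop0 by simp
qed (use L in simp)

section \<open>Multiplicities of the eigenvalues of the cross matrix\<close>

lemma char_poly_cross_matrix:
  fixes \<kappa> :: real
  assumes p: "p \<ge> 1" and h: "h > 0"
  defines "S \<equiv> cross_matrix p \<kappa> h"
  shows "char_poly S = [:- circ_eigenvalue S 0, 1:] *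
      (\<Prod>L\<in>{1..(p - 1) div 2}. [:- circ_eigenvalue S L, 1:] ^ 2) *
      (if even p then [:- circ_eigenvalue S (p div 2), 1:] else 1)"
  unfolding S_def char_poly_circulant[OF circulant_cross_matrix[OF h] p]
  by (rule prod_reflect[OF p]) (simp add: circ_eigenvalue_reflect[OF h])

lemma no_coincidence_cross_matrix:
  "no_coincidence (cross_matrix p \<kappa> h) L \<longleftrightarrow> (\<forall>M\<le>p div 2. M \<noteq> L \<longrightarrow>
     circ_eigenvalue (cross_matrix p \<kappa> h) M \<noteq> circ_eigenvalue (cross_matrix p \<kappa> h) L)"
  by (simp add: no_coincidence_def)

lemma eigenvalue_cross_matrix:
  assumes p: "p \<ge> 1" and h: "h > 0" and L: "L < p"
  shows "eigenvalue (cross_matrix p \<kappa> h) (circ_eigenvalue (cross_matrix p \<kappa> h) L)"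
  unfolding eigenvalue_root_char_poly[OF cross_matrix_dim(1)]
    char_poly_circulant[OF circulant_cross_matrix[OF h] p] poly_prod
  using L by (intro prod_zero bexI[of _ L]) auto

text \<open>Without coincidences, every other factor of the paired factorization is nonzero at the
  eigenvalue, so the order is the exponent of its own factor.\<close>

lemma order_circ_eigenvalue_cross_matrix:
  fixes \<kappa> :: real
  assumes p: "p \<ge> 1" and h: "h > 0" and nc: "no_coincidence (cross_matrix p \<kappa> h) L"
    and L: "L \<le> p div 2"
  defines "S \<equiv> cross_matrix p \<kappa> h"
  shows "Polynomial.order (circ_eigenvalue S L) (char_poly S) = (if L \<in> {1..(p - 1) div 2} then 2 else 1)"
proof -
  define ev where "ev = circ_eigenvalue S"
  define A where "A = {1..(p - 1) div 2}"
  define E where "E = (if even p then [:- ev (p div 2), 1:] else 1)"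
  define P where "P B = (\<Prod>L\<in>B. [:- ev L, 1:] ^ 2)" for B
  have cp: "char_poly S = [:- ev 0, 1:] * P A * E"
    unfolding S_def ev_def A_def P_def E_def by (rule char_poly_cross_matrix[OF p h])
  have ne: "ev L \<noteq> ev M" if "M \<le> p div 2" "M \<noteq> L" for M
    using nc that unfolding no_coincidence_cross_matrix ev_def S_def by metis
  have A_le: "M \<le> p div 2" if "M \<in> A" for M
    using that by (auto simp: A_def)
  have P: "poly (P B) (ev L) \<noteq> 0" if "B \<subseteq> A - {L}" for B
  proof -
    have "finite B" using that finite_subset[of B A] by (auto simp: A_def)
    then show ?thesis
      using that ne A_le by (auto simp: P_def poly_prod)
  qed
  have E: "poly E (ev L) \<noteq> 0" if "odd p \<or> L \<noteq> p div 2"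
    using that ne[of "p div 2"] by (auto simp: E_def)
  have Z: "poly [:- ev 0, 1:] (ev L) \<noteq> 0" if "L \<noteq> 0"
    using that ne[of 0] by auto
  have "L = 0 \<or> L \<in> A \<or> L \<noteq> 0 \<and> L \<notin> A \<and> even p \<and> L = p div 2"
    using L p unfolding A_def atLeastAtMost_iff by presburger
  then consider "L = 0" | "L \<in> A" | "L \<noteq> 0" "L \<notin> A" "even p" "L = p div 2"
    by blast
  then have "Polynomial.order (ev L) (char_poly S) = (if L \<in> A then 2 else 1)"
  proof cases
    case 1
    \<comment> \<open>For even \<open>p\<close>, \<open>p \<ge> 1\<close> gives
      \<open>p div 2 > 0\<close>, so the extra factor \<open>E\<close> does not belong to index
      0.\<close>
    then have "odd p \<or> L \<noteq> p div 2" "L \<notin> A" using p by (auto simp: A_def elim!: evenE)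
    moreover have "A \<subseteq> A - {L}" using \<open>L \<notin> A\<close> by auto
    ultimately have "poly (P A * E) (ev L) \<noteq> 0"
      using P E by simp
    moreover have "char_poly S = [:- ev L, 1:] ^ 1 * (P A * E)"
      unfolding cp 1 power_one_right mult.assoc ..
    ultimately show ?thesis
      using \<open>L \<notin> A\<close> by (simp only: if_False order_linear_power_mult not_False_eq_True)
  next
    case 2
    then have L0: "odd p \<or> L \<noteq> p div 2" "L \<noteq> 0" by (auto simp: A_def elim!: evenE)
    have "poly ([:- ev 0, 1:] * P (A - {L}) * E) (ev L) \<noteq> 0"
      using P[of "A - {L}"] E[OF L0(1)] Z[OF L0(2)] by (simp only: poly_mult mult_eq_0_iff) blast
    moreover have "P A = [:- ev L, 1:] ^ 2 * P (A - {L})"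
      unfolding P_def by (rule prod.remove) (use 2 in \<open>auto simp: A_def\<close>)
    then have "char_poly S = [:- ev L, 1:] ^ 2 * ([:- ev 0, 1:] * P (A - {L}) * E)"
      unfolding cp by (simp only: mult_ac)
    ultimately show ?thesis
      using 2 order_linear_power_mult[of "[:- ev 0, 1:] * P (A - {L}) * E" "ev L" 2] by simp
  next
    case 3
    have "A \<subseteq> A - {L}" using \<open>L \<notin> A\<close> by auto
    then have "poly ([:- ev 0, 1:] * P A) (ev L) \<noteq> 0"
      using P Z[OF \<open>L \<noteq> 0\<close>] by (simp only: poly_mult mult_eq_0_iff) blast
    moreover have "E = [:- ev L, 1:]" using 3 by (simp add: E_def)
    then have "char_poly S = [:- ev L, 1:] ^ 1 * ([:- ev 0, 1:] * P A)"
      unfolding cp power_one_right by (simp only: mult_ac)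
    ultimately show ?thesis
      using \<open>L \<notin> A\<close> by (simp only: if_False order_linear_power_mult not_False_eq_True)
  qed
  then show ?thesis
    unfolding ev_def A_def .
qed

section \<open>Fourier integrals of the generating function\<close>

lemma integral_twice_period:
  fixes f :: "real \<Rightarrow> 'a :: banach"
  assumes f: "continuous_on UNIV f" and per: "\<And>x. f (x + c) = f x" and "c \<ge> 0"
  shows "integral {0..2 * c} f = 2 *\<^sub>R integral {0..c} f"
proof -
  have "integral {0..2 * c} f = integral {0..c} f + integral {c..2 * c} f"
    using assms by (intro Henstock_Kurzweil_Integration.integral_combine[symmetric]
        integrable_continuous_interval continuous_on_subset[OF f]) auto
  also have "integral {c..2 * c} f = integral {0..c} f"
    using integral_shift_real_ivl[of c c "2 * c" f] by (simp add: per)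
  finally show ?thesis by (simp add: scaleR_2)
qed

lemma integral_symmetric_interval:
  fixes f :: "real \<Rightarrow> 'a :: banach"
  assumes f: "continuous_on UNIV f" and refl: "\<And>x. f (c - x) = f x" and "c \<ge> 0"
  shows "integral {0..c} f = 2 *\<^sub>R integral {0..c / 2} f"
proof -
  have "integral {0..c} f = integral {0..c / 2} f + integral {c / 2..c} f"
    using assms by (intro Henstock_Kurzweil_Integration.integral_combine[symmetric]
        integrable_continuous_interval continuous_on_subset[OF f]) auto
  also have "integral {c / 2..c} f = integral {- (c / 2)..0} (\<lambda>x. f (x + c))"
    using integral_shift_real_ivl[of "c / 2" c c f] by simp
  also have "\<dots> = integral {- (c / 2)..- 0} (\<lambda>x. f (- x))"
    using refl[of "- x" for x] by (simp add: add.commute)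
  also have "\<dots> = integral {0..c / 2} f"
    by (rule Henstock_Kurzweil_Integration.integral_reflect_real)
  finally show ?thesis by (simp add: scaleR_2)
qed

text \<open>Integrability passes both ways, through \<open>Re\<close> in one direction; where it
  fails, both integrals have the default value 0.\<close>

lemma integral_of_real_complex:
  "integral A (\<lambda>x. complex_of_real (f x)) = of_real (integral A f)"
proof (cases "f integrable_on A")
  case True
  then show ?thesis
    by (intro integral_unique has_integral_of_real integrable_integral)
next
  case False
  moreover have "f integrable_on A" if "(\<lambda>x. complex_of_real (f x)) integrable_on A"
    using integrable_linear[OF that bounded_linear_Re] by (simp add: o_def)
  ultimately have "\<not> (\<lambda>x. complex_of_real (f x)) integrable_on A" by blast
  with False show ?thesis by (simp add: not_integrable_integral)
qed

lemma integral_sin_bessel: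
  "integral {0..2 * pi} (\<lambda>u. of_real (sin u) * exp (\<i> * of_real (w * sin u))) =
     of_real (2 * pi * bessel_J_nat 1 w) * \<i>"
  using bessel_integral_cos[of 0 "pi / 2" w] by (simp add: cos_diff)

text \<open>Written with exponentials, the sine moves the frequency \<open>2 * L\<close> to
  \<open>2 * L + 1\<close> and \<open>2 * L - 1\<close>; \<open>L \<ge> 1\<close> keeps the lower
  order natural, so Bessel's integral covers both.\<close>

lemma integral_sin_bessel_fourier:
  assumes "L \<ge> 1"
  shows "integral {0..2 * pi} (\<lambda>y. of_real (sin y) * exp (\<i> * of_real (w * sin y)) * cis (- 2 * real L * y)) =
     of_real (pi * (bessel_J (2 * int L + 1) w - bessel_J (2 * int L - 1) w)) * \<i>"
proof -
  let ?f = "\<lambda>n y. exp (\<i> * of_real (w * sin (y - 0))) * cis (- real n * (y - 0))"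
  have "of_real (sin y) * exp (\<i> * of_real (w * sin y)) * cis (- 2 * real L * y) =
     (\<i> / 2) * ?f (2 * L + 1) y - (\<i> / 2) * ?f (2 * L - 1) y" for y
  proof -
    have "cis (- real (2 * L + 1) * y) = cis (- 2 * real L * y) * cis (- y)"
         "cis (- real (2 * L - 1) * y) = cis (- 2 * real L * y) * cis y"
      using assms by (simp_all add: cis_mult of_nat_diff algebra_simps)
    moreover have sin: "of_real (sin y) = (\<i> / 2) * cis (- y) - (\<i> / 2) * cis y"
      by (simp add: complex_eq_iff)
    ultimately show ?thesis
      unfolding diff_zero sin by (simp only:) (simp add: algebra_simps)
  qed
  then have "integral {0..2 * pi} (\<lambda>y. of_real (sin y) * exp (\<i> * of_real (w * sin y)) * cis (- 2 * real L * y)) =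
     (\<i> / 2) * integral {0..2 * pi} (?f (2 * L + 1)) - (\<i> / 2) * integral {0..2 * pi} (?f (2 * L - 1))"
    by (simp only: integral_diff integral_mult_right integrable_on_mult_right bessel_integrand_integrable)
  also have "\<dots> = of_real (pi * (bessel_J_nat (2 * L + 1) w - bessel_J_nat (2 * L - 1) w)) * \<i>"
    unfolding bessel_integral by (simp add: algebra_simps)
  also have "bessel_J_nat (2 * L + 1) w = bessel_J (2 * int L + 1) w"
    by (simp add: bessel_J_def nat_add_distrib nat_mult_distrib)
  also have "bessel_J_nat (2 * L - 1) w = bessel_J (2 * int L - 1) w"
    using assms by (simp add: bessel_J_def nat_diff_distrib nat_mult_distrib)
  finally show ?thesis .
qed

lemma bessel_fourier_integral:
  assumes "L \<ge> 1"
  shows "integral {0..2 * pi} (\<lambda>y. of_real (sin y * bessel_J 1 (z * sin y)) * cis (- 2 * real L * y)) =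
    of_real (integral {0..2 * pi} (\<lambda>u. sin u *
      (bessel_J (2 * int L + 1) (z * sin u) - bessel_J (2 * int L - 1) (z * sin u))) / 2)"
proof -
  \<comment> \<open>Integrating this kernel over \<open>u\<close> first gives the \<open>J_1\<close>
    integrand times \<open>2 * pi * \<i>\<close>; over \<open>y\<close> first, the difference of
    Bessel functions times \<open>pi * \<i>\<close>. The quotient is the factor 1/2.\<close>
  let ?g = "\<lambda>y u. of_real (sin y) * of_real (sin u) * exp (\<i> * of_real (z * sin y * sin u)) * cis (- 2 * real L * y)"
  have "integral (cbox 0 (2 * pi)) (\<lambda>y. integral (cbox 0 (2 * pi)) (?g y)) =
        integral (cbox 0 (2 * pi)) (\<lambda>u. integral (cbox 0 (2 * pi)) (\<lambda>y. ?g y u))"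
    unfolding cis_conv_exp
    by (rule integral_swap_continuous) (auto simp: case_prod_unfold intro!: continuous_intros)
  also have "(\<lambda>u. integral (cbox 0 (2 * pi)) (\<lambda>y. ?g y u)) = (\<lambda>u. pi * \<i> * of_real (sin u *
      (bessel_J (2 * int L + 1) (z * sin u) - bessel_J (2 * int L - 1) (z * sin u))))"
  proof
    fix u
    have "(\<lambda>y. ?g y u) = (\<lambda>y. of_real (sin u) *
        (of_real (sin y) * exp (\<i> * of_real ((z * sin u) * sin y)) * cis (- 2 * real L * y)))"
      by (simp add: mult_ac)
    then show "integral (cbox 0 (2 * pi)) (\<lambda>y. ?g y u) = pi * \<i> * of_real (sin u *
      (bessel_J (2 * int L + 1) (z * sin u) - bessel_J (2 * int L - 1) (z * sin u)))"
      by (simp only: cbox_interval integral_mult_right integral_sin_bessel_fourier[OF assms]) (simp add: mult_ac)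
  qed
  also have "(\<lambda>y. integral (cbox 0 (2 * pi)) (?g y)) =
     (\<lambda>y. 2 * pi * \<i> * (of_real (sin y * bessel_J 1 (z * sin y)) * cis (- 2 * real L * y)))"
  proof
    fix y
    have "?g y = (\<lambda>u. of_real (sin y) * cis (- 2 * real L * y) *
        (of_real (sin u) * exp (\<i> * of_real ((z * sin y) * sin u))))"
      by (simp add: mult_ac)
    then show "integral (cbox 0 (2 * pi)) (?g y) =
        2 * pi * \<i> * (of_real (sin y * bessel_J 1 (z * sin y)) * cis (- 2 * real L * y))"
      by (simp only: cbox_interval integral_mult_right integral_sin_bessel) (simp add: bessel_J_def mult_ac)
  qed
  finally show ?thesis
    unfolding cbox_interval integral_mult_right integral_of_real_complex by (simp add: field_simps)
qed

text \<open>Substituting \<open>y = x / 2\<close> halves the interval to one period of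
  \<open>\<phi>\<close>. Periodicity extends it to two periods, where
  \<open>bessel_fourier_integral\<close> applies, and the symmetries of \<open>G\<close> then reduce
  the result to a quarter of that interval.\<close>

lemma integral_F_S_fourier:
  assumes L: "L \<ge> 1"
  shows "integral {0..2 * pi} (\<lambda>x. complex_of_real (F_S \<kappa> h x) * exp (- (\<i> * of_nat L * complex_of_real x))) =
    of_real (- 4 * pi * \<kappa> * h * integral {0..pi / 2} (\<lambda>x. sin x *
       (bessel_J (2 * int L + 1) (2 * \<kappa> * h * sin x) - bessel_J (2 * int L - 1) (2 * \<kappa> * h * sin x))))"
proof -
  define z where "z = 2 * \<kappa> * h"
  define \<phi> where "\<phi> y = complex_of_real (sin y * bessel_J 1 (z * sin y)) * cis (- 2 * real L * y)" for y
  define G where "G x = sin x * (bessel_J (2 * int L + 1) (z * sin x) - bessel_J (2 * int L - 1) (z * sin x))" for x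
  have cont_\<phi>: "continuous_on S \<phi>" for S
    unfolding \<phi>_def cis_conv_exp by (intro continuous_intros)
  have cont_G: "continuous_on S G" for S
    unfolding G_def by (intro continuous_intros)
  have per_\<phi>: "\<phi> (x + pi) = \<phi> x" for x
  proof -
    have "cis (- 2 * real L * (x + pi)) = cis (- 2 * real L * x) * cis (2 * pi * (- real L))"
      by (simp add: cis_mult algebra_simps)
    also have "\<dots> = cis (- 2 * real L * x)"
      by (simp only: cis_multiple_2pi Ints_minus Ints_of_nat mult_1_right)
    finally show ?thesis
      by (simp only: \<phi>_def) (simp add: bessel_J_minus_odd)
  qed
  have per_G: "G (x + pi) = G x" and refl_G: "G (pi - x) = G x" for x
    by (simp_all add: G_def bessel_J_minus_odd algebra_simps)
  have "(\<phi> has_integral integral (cbox 0 pi) \<phi>) (cbox 0 pi)"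
    unfolding cbox_interval by (intro integrable_integral integrable_continuous_interval cont_\<phi>)
  from has_integral_affinity'[OF this, of "1 / 2" 0]
  have "integral {0..2 * pi} (\<lambda>x. \<phi> (x / 2)) = 2 *\<^sub>R integral {0..pi} \<phi>"
    by (intro integral_unique) (simp add: mult.commute)
  also have "\<dots> = integral {0..2 * pi} \<phi>"
    by (rule integral_twice_period[OF cont_\<phi> per_\<phi>, symmetric]) simp
  also have "\<dots> = of_real (integral {0..2 * pi} G / 2)"
    unfolding \<phi>_def G_def by (rule bessel_fourier_integral[OF L])
  \<comment> \<open>One factor 2 comes from the period \<open>pi\<close>, the other from the
    reflection about \<open>pi / 2\<close>.\<close>
  also have "integral {0..2 * pi} G = 4 * integral {0..pi / 2} G"
    using integral_twice_period[OF cont_G per_G] integral_symmetric_interval[OF cont_G refl_G] by simp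
  finally have int: "integral {0..2 * pi} (\<lambda>x. \<phi> (x / 2)) = of_real (2 * integral {0..pi / 2} G)"
    by simp
  have "complex_of_real (F_S \<kappa> h x) * exp (- (\<i> * of_nat L * complex_of_real x)) =
      of_real (- 2 * pi * \<kappa> * h) * \<phi> (x / 2)" for x
    by (simp add: F_S_def \<phi>_def z_def cis_conv_exp mult_ac)
  then show ?thesis
    using int unfolding G_def[abs_def] z_def by simp
qed

lemma continuous_on_F_S: "continuous_on S (F_S \<kappa> h)"
  unfolding F_S_def by (intro continuous_intros) auto

section \<open>Trapezoidal approximation of the eigenvalues\<close>

lemma trapezoidal_approx_cross_matrix:
  assumes h: "h > 0"
    and I: "I = complex_of_real (real p / (2 * pi)) * integral {0..2 * pi}
      (\<lambda>x. complex_of_real (F_S \<kappa> h x) * exp (- (\<i> * of_nat L * complex_of_real x)))"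
  shows "trapezoidal_approx p (F_S \<kappa> h) L (circ_eigenvalue (cross_matrix p \<kappa> h) L) I"
  unfolding trapezoidal_approx_def I
  by (auto simp: circ_eigenvalue_cross_matrix[OF h] circ_exp_cis
      intro!: integrable_continuous_interval continuous_intros continuous_on_F_S)

lemma trapezoidal_approx_bessel:
  assumes h: "h > 0" and L: "L \<ge> 1"
  shows "trapezoidal_approx p (F_S \<kappa> h) L (circ_eigenvalue (cross_matrix p \<kappa> h) L)
    (complex_of_real (- 2 * real p * \<kappa> * h * integral {0..pi / 2} (\<lambda>x. sin x *
       (bessel_J (2 * int L + 1) (2 * \<kappa> * h * sin x) - bessel_J (2 * int L - 1) (2 * \<kappa> * h * sin x)))))"
proof (rule trapezoidal_approx_cross_matrix[OF h])
  let ?I = "integral {0..pi / 2} (\<lambda>x. sin x *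
       (bessel_J (2 * int L + 1) (2 * \<kappa> * h * sin x) - bessel_J (2 * int L - 1) (2 * \<kappa> * h * sin x)))"
  have "- 2 * real p * \<kappa> * h * ?I = real p / (2 * pi) * (- 4 * pi * \<kappa> * h * ?I)"
    by (simp add: field_simps)
  then show "complex_of_real (- 2 * real p * \<kappa> * h * ?I) = complex_of_real (real p / (2 * pi)) *
      integral {0..2 * pi} (\<lambda>x. complex_of_real (F_S \<kappa> h x) * exp (- (\<i> * of_nat L * complex_of_real x)))"
    unfolding integral_F_S_fourier[OF L] of_real_mult[symmetric] by (rule arg_cong)
qed

lemma trapezoidal_approx_bessel_0:
  assumes h: "h > 0"
  shows "trapezoidal_approx p (F_S \<kappa> h) 0 (circ_eigenvalue (cross_matrix p \<kappa> h) 0)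
    (complex_of_real (- real p * \<kappa> * h *
      integral {0..2 * pi} (\<lambda>x. sin (x / 2) * bessel_J 1 (2 * \<kappa> * h * sin (x / 2)))))"
proof (rule trapezoidal_approx_cross_matrix[OF h])
  let ?I = "integral {0..2 * pi} (\<lambda>x. sin (x / 2) * bessel_J 1 (2 * \<kappa> * h * sin (x / 2)))"
  have "F_S \<kappa> h = (\<lambda>x. - 2 * pi * \<kappa> * h * (sin (x / 2) * bessel_J 1 (2 * \<kappa> * h * sin (x / 2))))"
    by (simp add: F_S_def fun_eq_iff)
  then have "integral {0..2 * pi} (F_S \<kappa> h) = - 2 * pi * \<kappa> * h * ?I"
    by (simp only: Henstock_Kurzweil_Integration.integral_mult_right)
  then have I: "integral {0..2 * pi} (\<lambda>x. complex_of_real (F_S \<kappa> h x) *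
      exp (- (\<i> * of_nat 0 * complex_of_real x))) = of_real (- 2 * pi * \<kappa> * h * ?I)"
    by (simp add: integral_of_real_complex)
  have "- real p * \<kappa> * h * ?I = real p / (2 * pi) * (- 2 * pi * \<kappa> * h * ?I)"
    by (simp add: field_simps)
  then show "complex_of_real (- real p * \<kappa> * h * ?I) = complex_of_real (real p / (2 * pi)) *
      integral {0..2 * pi} (\<lambda>x. complex_of_real (F_S \<kappa> h x) * exp (- (\<i> * of_nat 0 * complex_of_real x)))"
    unfolding I of_real_mult[symmetric] by (rule arg_cong)
qed

section \<open>Coincident eigenvalues\<close>

text \<open>Both factors are odd in \<open>y\<close>, so the product is a power series in the square
  of \<open>y\<close>; this is why eigenvalue differences become series in the squared wave
  number.\<close>

lemma bessel_J_1_sums: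
  "(\<lambda>n. (-1) ^ n / (fact n * fact (n + 1)) * (y\<^sup>2) ^ Suc n) sums (y * bessel_J 1 (2 * y))"
proof -
  have "(\<lambda>n. y * ((-1) ^ n / (fact n * fact (n + 1)) * (2 * y / 2) ^ (2 * n + 1))) sums (y * bessel_J_nat 1 (2 * y))"
    by (intro sums_mult bessel_J_nat_sums)
  moreover have "y * ((-1) ^ n / (fact n * fact (n + 1)) * (2 * y / 2) ^ (2 * n + 1)) =
      (-1) ^ n / (fact n * fact (n + 1)) * (y\<^sup>2) ^ Suc n" for n
    by (simp add: power_mult power_add power2_eq_square power_mult_distrib mult_ac)
  ultimately show ?thesis
    by (simp only:) (simp add: bessel_J_def)
qed

text \<open>The sum is entire. It vanishes at 0 but, having a nonzero coefficient, not on a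
  punctured disk around 0; hence it is not constant and its zeros are countable.\<close>

lemma countable_zeros_power_series:
  fixes a :: "nat \<Rightarrow> complex"
  assumes conv: "\<And>z. summable (\<lambda>n. a n * z ^ n)" and "a 0 = 0" "a m \<noteq> 0"
  shows "countable {z. (\<Sum>n. a n * z ^ n) = 0}"
proof -
  let ?f = "\<lambda>z. \<Sum>n. a n * z ^ n"
  have f0: "?f 0 = 0" using \<open>a 0 = 0\<close> by (simp add: powser_zero)
  have m: "m > 0" using assms(2,3) by (cases m) auto
  obtain s where s: "0 < s" "\<And>z. z \<in> cball 0 s - {0} \<Longrightarrow> ?f z \<noteq> 0"
  proof (rule powser_0_nonzero[of 1 0 a ?f m])
    show "(\<lambda>n. a n * (x - 0) ^ n) sums ?f x" for x
      unfolding diff_zero by (rule summable_sums[OF conv])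
  qed (use f0 m assms(3) in simp_all)
  have fs: "?f (of_real s) \<noteq> 0" by (rule s(2)) (use s(1) in simp)
  have "\<not> ?f constant_on UNIV"
  proof
    assume "?f constant_on UNIV"
    then obtain c where c: "?f z = c" for z unfolding constant_on_def by blast
    from fs f0 show False unfolding c by blast
  qed
  moreover have "?f holomorphic_on UNIV"
    by (rule holomorphic_onI)
       (rule field_differentiable_at_within, unfold field_differentiable_def,
        rule exI, rule termdiffs_strong_converges_everywhere[OF conv])
  ultimately have "countable {z \<in> UNIV. ?f z = 0}"
    by (intro holomorphic_countable_zeros) (auto simp: fsigma_UNIV)
  then show ?thesis by simp
qed

text \<open>Up to index \<open>p div 2\<close> the angles lie in the interval from 0 to
  \<open>pi\<close>, where the cosine is injective.\<close>

lemma cos_root_eq_iff: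
  assumes "p \<ge> 1" "a \<le> p div 2" "b \<le> p div 2"
    "cos (2 * pi * real a / real p) = cos (2 * pi * real b / real p)"
  shows "a = b"
proof -
  have le: "2 * pi * real k / real p \<le> pi" if "k \<le> p div 2" for k
  proof -
    have "2 * k \<le> p" using that by simp
    then have "2 * real k \<le> real p" by linarith
    then have "pi * (2 * real k) \<le> pi * real p" by (intro mult_left_mono) auto
    then show ?thesis using assms(1) by (simp add: divide_le_eq mult_ac)
  qed
  have "2 * pi * real a / real p = 2 * pi * real b / real p"
    by (rule cos_inj_pi) (simp_all add: le assms)
  then show ?thesis using assms(1) by simp
qed

lemma cos_root_reflect:
  assumes "p \<ge> 1" "j \<le> p"
  shows "cos (2 * pi * real (p - j) * real L / real p) = cos (2 * pi * real j * real L / real p)"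
proof -
  have "2 * pi * real (p - j) * real L / real p = 2 * pi * real L - 2 * pi * real j * real L / real p"
    unfolding of_nat_diff[OF assms(2)] using assms(1)
    by (simp add: right_diff_distrib left_diff_distrib diff_divide_distrib)
  then show ?thesis
    by (simp only: cos_diff cos_integer_2pi sin_integer_2pi Ints_of_nat mult_1_left mult_zero_left add_0_right)
qed

text \<open>If all moments vanished, then so would the sum of
  \<open>w j * s j * poly q (s j)\<close> for every polynomial \<open>q\<close>. A suitable
  \<open>q\<close> isolates the indices 1 and \<open>p - 1\<close>, which share node and weight, and
  forces \<open>w 1 = 0\<close>.\<close>

lemma nonzero_moment:
  assumes LM: "L \<le> p div 2" "M \<le> p div 2" "L \<noteq> M"
  shows "\<exists>n. (\<Sum>j<p. (cos (2 * pi * real j * real L / real p) - cos (2 * pi * real j * real M / real p)) *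
     ((sin (pi * real j / real p))\<^sup>2) ^ Suc n) \<noteq> 0"
proof (rule ccontr)
  define w where "w j = cos (2 * pi * real j * real L / real p) - cos (2 * pi * real j * real M / real p)" for j
  define s where "s j = (sin (pi * real j / real p))\<^sup>2" for j
  assume "\<not> ?thesis"
  then have mom: "(\<Sum>j<p. w j * s j ^ Suc n) = 0" for n
    unfolding w_def s_def by blast
  have p: "p \<ge> 2" using LM by linarith
  have s_cos: "s j = (1 - cos (2 * pi * real j / real p)) / 2" for j
    using cos_double_sin[of "pi * real j / real p"] by (simp add: s_def mult.assoc)
  have refl: "w (p - 1) = w 1" "s (p - 1) = s 1"
    using cos_root_reflect[of p 1 L] cos_root_reflect[of p 1 M] cos_root_reflect[of p 1 1] p
    unfolding w_def s_cos by simp_all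
  \<comment> \<open>\<open>q\<close> vanishes at the nodes of all indices other than 0, 1 and
    \<open>p - 1\<close>; index 0 drops out because \<open>s 0 = 0\<close>.\<close>
  define q where "q = (\<Prod>i\<in>{2..<p - 1}. [:- s i, 1:])"
  have "(\<Sum>j<p. w j * (s j * poly q (s j))) = (\<Sum>n\<le>degree q. coeff q n * (\<Sum>j<p. w j * s j ^ Suc n))"
    unfolding poly_altdef sum_distrib_left by (subst sum.swap) (simp add: mult_ac)
  then have zero: "(\<Sum>j<p. w j * (s j * poly q (s j))) = 0"
    by (simp only: mom mult_zero_right sum.neutral_const)
  have "(\<Sum>j<p. w j * (s j * poly q (s j))) = (\<Sum>j\<in>{1, p - 1}. w j * (s j * poly q (s j)))"
  proof (rule sum.mono_neutral_right)
    show "\<forall>j\<in>{..<p} - {1, p - 1}. w j * (s j * poly q (s j)) = 0"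
    proof
      fix j assume j: "j \<in> {..<p} - {1, p - 1}"
      show "w j * (s j * poly q (s j)) = 0"
      proof (cases "j = 0")
        case False
        then have "j \<in> {2..<p - 1}" using j by auto
        then have "poly q (s j) = 0"
          unfolding q_def poly_prod by (intro prod_zero bexI[of _ j]) simp_all
        then show ?thesis by simp
      qed (simp add: s_def)
    qed
  qed (use p in auto)
  \<comment> \<open>The two indices coincide when \<open>p = 2\<close>; keeping the cardinality,
    which is nonzero in any case, avoids a case split.\<close>
  also have "\<dots> = real (card {1, p - 1}) * (w 1 * (s 1 * poly q (s 1)))"
  proof -
    have "(\<Sum>j\<in>{1, p - 1}. w j * (s j * poly q (s j))) = (\<Sum>j\<in>{1, p - 1}. w 1 * (s 1 * poly q (s 1)))"
      by (intro sum.cong HOL.refl) (use refl in auto)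
    then show ?thesis by (simp only: sum_constant)
  qed
  finally have "real (card {1, p - 1}) * (w 1 * (s 1 * poly q (s 1))) = 0"
    unfolding zero by (rule sym)
  moreover have "card {1, p - 1} \<noteq> 0" by simp
  ultimately have "w 1 = 0 \<or> s 1 = 0 \<or> poly q (s 1) = 0"
    by simp
  \<comment> \<open>Only index 1 and its reflection share the node \<open>s 1\<close>, so neither
    \<open>s 1\<close> nor \<open>poly q (s 1)\<close> can vanish.\<close>
  moreover have cos_eqD: "i = 1 \<or> i = p - 1" if "i < p" "s i = s 1" for i
  proof (cases "i \<le> p div 2")
    case True
    with that p show ?thesis
      by (intro disjI1 cos_root_eq_iff[of p i 1]) (simp_all add: s_cos)
  next
    case False
    have "cos (2 * pi * real (p - i) / real p) = cos (2 * pi * real 1 / real p)"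
      using cos_root_reflect[of p i 1] that p by (simp add: s_cos)
    then have "p - i = 1"
      using False p by (intro cos_root_eq_iff[of p]) auto
    then show ?thesis using that(1) by arith
  qed
  have "s 1 \<noteq> 0"
  proof
    assume "s 1 = 0"
    then have "s 0 = s 1" by (simp add: s_def)
    from cos_eqD[OF _ this] p show False by auto
  qed
  moreover have "poly q (s 1) \<noteq> 0"
  proof
    assume "poly q (s 1) = 0"
    then obtain i where "i \<in> {2..<p - 1}" "poly [:- s i, 1:] (s 1) = 0"
      unfolding q_def poly_prod prod_zero_iff[OF finite_atLeastLessThan] by blast
    then have "s i = s 1" by simp
    moreover have "i < p" "i \<noteq> 1" "i \<noteq> p - 1"
      using \<open>i \<in> {2..<p - 1}\<close> by auto
    ultimately show False using cos_eqD by blast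
  qed
  ultimately have "w 1 = 0" by blast
  then have "L = M"
    by (intro cos_root_eq_iff[of p L M] LM) (use p in \<open>simp_all add: w_def\<close>)
  with LM show False by simp
qed

text \<open>The real part of the eigenvalue difference is a constant times a power series in
  \<open>k\<^sup>2\<close>, whose coefficients are nonzero multiples of the moments. By
  \<open>nonzero_moment\<close> one of them is nonzero.\<close>

lemma countable_coincidences:
  assumes h: "h > 0" and LM: "L \<le> p div 2" "M \<le> p div 2" "L \<noteq> M"
  shows "countable {k. circ_eigenvalue (cross_matrix p k h) L = circ_eigenvalue (cross_matrix p k h) M}"
proof -
  define w where "w j = cos (2 * pi * real j * real L / real p) - cos (2 * pi * real j * real M / real p)" for j
  define t where "t j = sin (pi * real j / real p)" for j
  define b :: "nat \<Rightarrow> real" where "b n = (-1) ^ n / (fact n * fact (n + 1))" for n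
  \<comment> \<open>The coefficients of the series in \<open>k\<^sup>2\<close>, shifted by one
    because it starts at the first power.\<close>
  define a where "a = case_nat 0 (\<lambda>n. complex_of_real (b n * (h\<^sup>2) ^ Suc n * (\<Sum>j<p. w j * (t j)\<^sup>2 ^ Suc n)))"
  let ?f = "\<lambda>z. \<Sum>n. a n * z ^ n"
  obtain n where n: "(\<Sum>j<p. w j * (t j)\<^sup>2 ^ Suc n) \<noteq> 0"
    using nonzero_moment[OF LM] unfolding w_def t_def by blast
  have "b n \<noteq> 0" by (simp add: b_def)
  then have an: "a (Suc n) \<noteq> 0"
    using h n unfolding a_def nat.case of_real_eq_0_iff by simp
  have a0: "a 0 = 0" by (simp add: a_def)
  have sums: "(\<lambda>n. a n * of_real (k\<^sup>2) ^ n) sums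
      of_real (\<Sum>j<p. w j * (k * h * t j * bessel_J 1 (2 * (k * h * t j))))" for k
  proof -
    have "(\<lambda>n. \<Sum>j<p. w j * (b n * ((k * h * t j)\<^sup>2) ^ Suc n)) sums
        (\<Sum>j<p. w j * (k * h * t j * bessel_J 1 (2 * (k * h * t j))))"
      unfolding b_def by (intro sums_sum sums_mult bessel_J_1_sums)
    then have "(\<lambda>n. complex_of_real (\<Sum>j<p. w j * (b n * ((k * h * t j)\<^sup>2) ^ Suc n))) sums
        of_real (\<Sum>j<p. w j * (k * h * t j * bessel_J 1 (2 * (k * h * t j))))"
      by (rule sums_of_real)
    moreover have "complex_of_real (\<Sum>j<p. w j * (b n * ((k * h * t j)\<^sup>2) ^ Suc n)) =
        a (Suc n) * of_real (k\<^sup>2) ^ Suc n" for n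
    proof -
      have "(\<Sum>j<p. w j * (b n * ((k * h * t j)\<^sup>2) ^ Suc n)) =
          b n * (h\<^sup>2) ^ Suc n * (\<Sum>j<p. w j * (t j)\<^sup>2 ^ Suc n) * (k\<^sup>2) ^ Suc n"
        unfolding sum_distrib_left sum_distrib_right
        by (intro sum.cong refl) (simp only: power_mult_distrib mult_ac)
      then show ?thesis by (simp add: a_def)
    qed
    ultimately have "(\<lambda>n. a (Suc n) * of_real (k\<^sup>2) ^ Suc n) sums
        of_real (\<Sum>j<p. w j * (k * h * t j * bessel_J 1 (2 * (k * h * t j))))"
      by (simp only:)
    then show ?thesis
      by (subst (asm) sums_Suc_iff) (simp add: a_def)
  qed
  \<comment> \<open>Convergence is known at squares of real numbers; \<open>norm z + 1\<close> is
    such a square and lies outside the circle through \<open>z\<close>.\<close>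
  have conv: "summable (\<lambda>n. a n * z ^ n)" for z
  proof (rule powser_inside)
    show "summable (\<lambda>n. a n * of_real ((sqrt (norm z + 1))\<^sup>2) ^ n)"
      using sums by (rule sums_summable)
  qed simp
  have "countable {z. ?f z = 0}"
    by (rule countable_zeros_power_series[OF conv a0 an])
  \<comment> \<open>The zeros are values of \<open>k\<^sup>2\<close>, so each accounts for at most
    the two wave numbers given by its square roots.\<close>
  then have "countable ((\<lambda>z. sqrt (Re z)) ` {z. ?f z = 0} \<union> (\<lambda>z. - sqrt (Re z)) ` {z. ?f z = 0})"
    by auto
  moreover have "{k. circ_eigenvalue (cross_matrix p k h) L = circ_eigenvalue (cross_matrix p k h) M} \<subseteq>
     (\<lambda>z. sqrt (Re z)) ` {z. ?f z = 0} \<union> (\<lambda>z. - sqrt (Re z)) ` {z. ?f z = 0}"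
  proof
    fix k assume "k \<in> {k. circ_eigenvalue (cross_matrix p k h) L = circ_eigenvalue (cross_matrix p k h) M}"
    then have "Re (circ_eigenvalue (cross_matrix p k h) L) - Re (circ_eigenvalue (cross_matrix p k h) M) = 0"
      by simp
    then have "(\<Sum>j<p. F_S k h (2 * pi * real j / real p) * w j) = 0"
      unfolding circ_eigenvalue_cross_matrix[OF h] Re_sum sum_subtractf[symmetric]
      by (simp add: w_def right_diff_distrib)
    moreover have "F_S k h (2 * pi * real j / real p) * w j =
        - 2 * pi * (w j * (k * h * t j * bessel_J 1 (2 * (k * h * t j))))" for j
      by (simp add: F_S_def t_def mult_ac)
    ultimately have "- 2 * pi * (\<Sum>j<p. w j * (k * h * t j * bessel_J 1 (2 * (k * h * t j)))) = 0"
      unfolding sum_distrib_left by (simp only:)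
    then have "(\<Sum>j<p. w j * (k * h * t j * bessel_J 1 (2 * (k * h * t j)))) = 0"
      by simp
    then have zero: "of_real (k\<^sup>2) \<in> {z. ?f z = 0}"
      using sums_unique[OF sums[of k]] by simp
    have "k = sqrt (Re (of_real (k\<^sup>2))) \<or> k = - sqrt (Re (of_real (k\<^sup>2)))"
      by (auto simp: abs_if)
    with zero show "k \<in> (\<lambda>z. sqrt (Re z)) ` {z. ?f z = 0} \<union> (\<lambda>z. - sqrt (Re z)) ` {z. ?f z = 0}"
      by (elim disjE) (blast intro: image_eqI)+
  qed
  ultimately show ?thesis
    by (rule countable_subset[rotated])
qed

text \<open>A finite union over pairs of indices. For fixed \<open>p\<close> and \<open>h\<close>,
  the exact multiplicities thus hold for all but countably many wave numbers.\<close>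

lemma countable_coincident_wave_numbers:
  assumes h: "h > 0"
  shows "countable {k. \<exists>L\<le>p div 2. \<not> no_coincidence (cross_matrix p k h) L}"
proof -
  have "{k. \<exists>L\<le>p div 2. \<not> no_coincidence (cross_matrix p k h) L} \<subseteq>
      (\<Union>L\<le>p div 2. \<Union>M\<in>{..p div 2} - {L}.
        {k. circ_eigenvalue (cross_matrix p k h) M = circ_eigenvalue (cross_matrix p k h) L})"
    by (fastforce simp: no_coincidence_cross_matrix)
  moreover have "countable (\<Union>L\<le>p div 2. \<Union>M\<in>{..p div 2} - {L}.
        {k. circ_eigenvalue (cross_matrix p k h) M = circ_eigenvalue (cross_matrix p k h) L})"
    by (intro countable_UN countable_finite countable_coincidences[OF h]) auto
  ultimately show ?thesis by (rule countable_subset)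
qed

text \<open>The exact orders are conditional because eigenvalues may coincide: for
  \<open>\<kappa> = 0\<close> the matrix is zero. The paired factorization of the characteristic
  polynomial holds regardless.\<close>

theorem theorem3p4:
  fixes p :: nat and \<kappa> h :: real and S :: "complex mat"
  assumes p: "p \<ge> 1" and h: "h > 0"
    and S: "S = cross_matrix p \<kappa> h"
  shows
    "(circulant p S \<and>
      char_poly S = (\<Prod>L<p. [:- circ_eigenvalue S L, 1:]) \<and>
      generating_function (\<lambda>x. complex_of_real (F_S \<kappa> h x)) S)
     \<and>
     (char_poly S =
        [:- circ_eigenvalue S 0, 1:] *
        (\<Prod>L\<in>{1..(p - 1) div 2}. [:- circ_eigenvalue S L, 1:] ^ 2) *
        (if even p then [:- circ_eigenvalue S (p div 2), 1:] else 1) \<and>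
      countable {k. \<exists>L\<le>p div 2. \<not> no_coincidence (cross_matrix p k h) L})
     \<and>
     (eigenvalue S (circ_eigenvalue S 0) \<and>
      (no_coincidence S 0 \<longrightarrow> Polynomial.order (circ_eigenvalue S 0) (char_poly S) = 1) \<and>
      circ_eigenvalue S 0 = (\<Sum>j<p. complex_of_real (F_S \<kappa> h (2 * real j / real p * pi))) \<and>
      trapezoidal_approx p (F_S \<kappa> h) 0 (circ_eigenvalue S 0)
        (complex_of_real (- real p * \<kappa> * h *
           integral {0..2 * pi} (\<lambda>x. sin (x / 2) * bessel_J 1 (2 * \<kappa> * h * sin (x / 2))))))
     \<and>
     (\<forall>L\<in>{1..(p - 1) div 2}.
        eigenvalue S (circ_eigenvalue S L) \<and>
        (no_coincidence S L \<longrightarrow> Polynomial.order (circ_eigenvalue S L) (char_poly S) = 2) \<and>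
        circ_eigenvalue S L =
          (\<Sum>j<p. complex_of_real (F_S \<kappa> h (2 * real j / real p * pi)) *
             exp (- \<i> * complex_of_real (2 * real j / real p * real L * pi))) \<and>
        trapezoidal_approx p (F_S \<kappa> h) L (circ_eigenvalue S L)
          (complex_of_real (- 2 * real p * \<kappa> * h *
             integral {0..pi / 2} (\<lambda>x. sin x *
               (bessel_J (2 * int L + 1) (2 * \<kappa> * h * sin x)
                - bessel_J (2 * int L - 1) (2 * \<kappa> * h * sin x))))))
     \<and>
     (even p \<longrightarrow>
        eigenvalue S (circ_eigenvalue S (p div 2)) \<and>
        (no_coincidence S (p div 2) \<longrightarrow>
           Polynomial.order (circ_eigenvalue S (p div 2)) (char_poly S) = 1) \<and>
        circ_eigenvalue S (p div 2) =
          (\<Sum>j<p. (-1) ^ j * complex_of_real (F_S \<kappa> h (2 * real j / real p * pi))) \<and>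
        trapezoidal_approx p (F_S \<kappa> h) (p div 2) (circ_eigenvalue S (p div 2))
          (complex_of_real (- 2 * real p * \<kappa> * h *
             integral {0..pi / 2} (\<lambda>x. sin x *
               (bessel_J (int p + 1) (2 * \<kappa> * h * sin x)
                - bessel_J (int p - 1) (2 * \<kappa> * h * sin x))))))"
proof (intro conjI ballI impI)
  have sum: "circ_eigenvalue S L = (\<Sum>j<p. complex_of_real (F_S \<kappa> h (2 * real j / real p * pi)) *
      exp (- \<i> * complex_of_real (2 * real j / real p * real L * pi)))" for L
    unfolding S circ_eigenvalue_cross_matrix[OF h] by (simp add: cis_conv_exp mult_ac)
  have order: "Polynomial.order (circ_eigenvalue S L) (char_poly S) = (if L \<in> {1..(p - 1) div 2} then 2 else 1)"
    if "no_coincidence S L" "L \<le> p div 2" for L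
    using order_circ_eigenvalue_cross_matrix[OF p h] that unfolding S by blast
  show "circulant p S"
    unfolding S by (rule circulant_cross_matrix[OF h])
  then show "char_poly S = (\<Prod>L<p. [:- circ_eigenvalue S L, 1:])"
    using p by (rule char_poly_circulant)
  show "generating_function (\<lambda>x. complex_of_real (F_S \<kappa> h x)) S"
    by (simp add: generating_function_def S cross_matrix_first_row[OF h])
  show "char_poly S = [:- circ_eigenvalue S 0, 1:] *
        (\<Prod>L\<in>{1..(p - 1) div 2}. [:- circ_eigenvalue S L, 1:] ^ 2) *
        (if even p then [:- circ_eigenvalue S (p div 2), 1:] else 1)"
    unfolding S by (rule char_poly_cross_matrix[OF p h])
  show "countable {k. \<exists>L\<le>p div 2. \<not> no_coincidence (cross_matrix p k h) L}"
    by (rule countable_coincident_wave_numbers[OF h])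
  show "eigenvalue S (circ_eigenvalue S 0)"
    unfolding S by (rule eigenvalue_cross_matrix[OF p h]) (use p in simp)
  show "Polynomial.order (circ_eigenvalue S 0) (char_poly S) = 1" if "no_coincidence S 0"
    using order[OF that] by simp
  show "circ_eigenvalue S 0 = (\<Sum>j<p. complex_of_real (F_S \<kappa> h (2 * real j / real p * pi)))"
    unfolding sum by simp
  show "trapezoidal_approx p (F_S \<kappa> h) 0 (circ_eigenvalue S 0)
      (complex_of_real (- real p * \<kappa> * h *
        integral {0..2 * pi} (\<lambda>x. sin (x / 2) * bessel_J 1 (2 * \<kappa> * h * sin (x / 2)))))"
    unfolding S by (rule trapezoidal_approx_bessel_0[OF h])
  {
    fix L assume L: "L \<in> {1..(p - 1) div 2}"
    show "eigenvalue S (circ_eigenvalue S L)"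
      unfolding S by (rule eigenvalue_cross_matrix[OF p h]) (use L in auto)
    show "Polynomial.order (circ_eigenvalue S L) (char_poly S) = 2" if "no_coincidence S L"
      using order[OF that] L by auto
    show "circ_eigenvalue S L = (\<Sum>j<p. complex_of_real (F_S \<kappa> h (2 * real j / real p * pi)) *
        exp (- \<i> * complex_of_real (2 * real j / real p * real L * pi)))"
      by (rule sum)
    show "trapezoidal_approx p (F_S \<kappa> h) L (circ_eigenvalue S L)
        (complex_of_real (- 2 * real p * \<kappa> * h *
          integral {0..pi / 2} (\<lambda>x. sin x *
            (bessel_J (2 * int L + 1) (2 * \<kappa> * h * sin x)
              - bessel_J (2 * int L - 1) (2 * \<kappa> * h * sin x)))))"
      unfolding S by (rule trapezoidal_approx_bessel[OF h]) (use L in simp)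
  }
  {
    assume even: "even p"
    \<comment> \<open>The third fact selects order 1 for the middle index; the fourth turns the
      Bessel orders \<open>2 * L + 1\<close> and \<open>2 * L - 1\<close> into \<open>p + 1\<close>
      and \<open>p - 1\<close>.\<close>
    then have p2: "p div 2 \<ge> 1" "p div 2 < p" "p div 2 \<notin> {1..(p - 1) div 2}" "int p = 2 * int (p div 2)"
      using p by (auto elim!: evenE)
    show "eigenvalue S (circ_eigenvalue S (p div 2))"
      unfolding S by (rule eigenvalue_cross_matrix[OF p h p2(2)])
    show "Polynomial.order (circ_eigenvalue S (p div 2)) (char_poly S) = 1" if "no_coincidence S (p div 2)"
      using order[OF that] p2(3) by simp
    have "exp (- \<i> * complex_of_real (2 * real j / real p * real (p div 2) * pi)) = (-1) ^ j" for j
    proof -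
      have "2 * real j / real p * real (p div 2) * pi = real j * pi"
        using even p by (auto elim!: evenE)
      then have "exp (- \<i> * complex_of_real (2 * real j / real p * real (p div 2) * pi)) = cis (real j * (- pi))"
        by (simp only: cis_conv_exp) simp
      also have "\<dots> = cis (- pi) ^ j"
        by (rule Complex.DeMoivre[symmetric])
      also have "cis (- pi) = -1"
        by (simp add: complex_eq_iff)
      finally show ?thesis .
    qed
    then show "circ_eigenvalue S (p div 2) =
        (\<Sum>j<p. (-1) ^ j * complex_of_real (F_S \<kappa> h (2 * real j / real p * pi)))"
      unfolding sum by (simp only: mult.commute)
    show "trapezoidal_approx p (F_S \<kappa> h) (p div 2) (circ_eigenvalue S (p div 2))
        (complex_of_real (- 2 * real p * \<kappa> * h *
          integral {0..pi / 2} (\<lambda>x. sin x *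
            (bessel_J (int p + 1) (2 * \<kappa> * h * sin x)
              - bessel_J (int p - 1) (2 * \<kappa> * h * sin x)))))"
      unfolding S p2(4) by (rule trapezoidal_approx_bessel[OF h p2(1)])
  }
qed

end
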